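(* Assume the following. (A1) For all $\theta\in\Theta$ and $q\in\{1,\dots,Q\}$, under $P_{\theta^*}$ the random variable $\ell_q(X,\theta)$ is continuous (its distribution has no atoms); in addition, the function $t\mapsto \mathbb{P}_{\theta^*}(T(X,\theta)<t)$ is (strictly) increasing on $(\alpha_c,\bar\alpha)$. (A2) For $P_{\theta^*}$-almost all $x\in\mathbb{R}^d$, the map $u\in\mathcal{U}\mapsto f_u(x)$ is continuous. (A3) The VC dimensions $\mathscr{V}$ and $\mathscr{V}_{-}$ are finite. Consider an estimator $\hat\theta$ of $\theta^*$ which takes its values in a countable subset $\mathcal{D}$ of $\Theta$ and which is consistent in the sense that, for all $\epsilon>0$, the probability $$\eta(\epsilon,\theta^* )=\mathbb{P}_{\theta^*}\Big(\min_{\sigma\in[Q]}\|\hat\theta^\sigma-\theta^*\|_2\ge\epsilon\Big)$$ tends to $0$ as $n$ tends to infinity. Then the corresponding plug-in procedure $\widehat{\mathcal{C}}^{\rm PI}_\alpha=(\widehat{\mathbf{Z}}^{\rm PI},\widehat{S}^{\rm PI}_\alpha)$ satisfies the following: for any $\alpha\in(\alpha_c,\bar\alpha)$, $$\limsup_n \mathrm{FMR}_{\theta^*}(\widehat{\mathcal{C}}^{\rm PI}_\alpha)\le\alpha,\qquad \limsup_n \mathrm{mFMR}_{\theta^*}(\widehat{\mathcal{C}}^{\rm PI}_\alpha)\le\alpha,$$ and for any procedure $\mathcal{C}=(\widehat{\mathbf{Z}},S)$ (given for each sample size $n$) that controls the mFMR at level $\alpha$, i.e. $\mathrm{mFMR}_{\theta^*}(\mathcal{C})\le\alpha$,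 $$\liminf_n\left\{n^{-1}\mathbb{E}_{\theta^*}(|\widehat{S}^{\rm PI}_\alpha|)-n^{-1}\mathbb{E}_{\theta^*}(|S|)\right\}\ge0.$$
   Context: Model. The number of classes $Q$ is fixed. $\{F_u,u\in\mathcal{U}\}$ is a family of distributions on $\mathbb{R}^d$ with Lebesgue densities $f_u$. A parameter is $\theta=(\pi,\phi)$ with $\pi=(\pi_1,\dots,\pi_Q)$ a probability vector with all $\pi_q>0$, and $\phi=(\phi_1,\dots,\phi_Q)\in\mathcal{U}^Q$ with distinct $\phi_q$'s; the parameter set $\Theta$ is an open subset of $\mathbb{R}^K$ for some $K\ge1$. $P_\theta$ is the law of $(Z,X)$ with $\mathbb{P}(Z=q)=\pi_q$ and $X\mid Z=q\sim F_{\phi_q}$. The true parameter $\theta^*\in\Theta$ is fixed; $(Z_i,X_i)$, $1\le i\le n$, are i.i.d. with law $P_{\theta^*}$; $\mathbf{X}=(X_1,\dots,X_n)$ is observed and $\mathbf{Z}=(Z_1,\dots,Z_n)$ is latent. $\mathbb{P}_{\theta^*},\mathbb{E}_{\theta^*}$ denote the corresponding probability and expectation. Posterior quantities: $\ell_q(X,\theta)=\mathbb{P}_\theta(Z=q\mid X)=\pi_qf_{\phi_q}(X)/\sum_{\ell=1}^Q\pi_\ell f_{\phi_\ell}(X)$ and $T(X,\theta)=1-\max_{1\le q\le Q}\ell_q(X,\theta)$. Procedures: a procedure is a pair $\mathcal{C}=(\widehat{\mathbf{Z}},S)$ of measurable functions of $\mathbf{X}$, with $\widehat{\mathbf{Z}}\in\{1,\dots,Q\}^n$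 and $S\subset\{1,\dots,n\}$. $[Q]$ is the set of permutations of $\{1,\dots,Q\}$, $\sigma(\widehat{\mathbf{Z}})=(\sigma(\hat Z_i))_i$, and $\varepsilon_S(\widehat{\mathbf{Z}},\mathbf{Z})=\sum_{i\in S}\mathbf{1}\{Z_i\neq\hat Z_i\}$. Then $\mathrm{FMR}_{\theta^*}(\mathcal{C})=\mathbb{E}_{\theta^*}\big(\min_{\sigma\in[Q]}\mathbb{E}_{\theta^*}\big(\varepsilon_S(\sigma(\widehat{\mathbf{Z}}),\mathbf{Z})/\max(|S|,1)\mid\mathbf{X}\big)\big)$ and $\mathrm{mFMR}_{\theta^*}(\mathcal{C})=\mathbb{E}_{\theta^*}\big(\min_{\sigma\in[Q]}\mathbb{E}_{\theta^*}(\varepsilon_S(\sigma(\widehat{\mathbf{Z}}),\mathbf{Z})\mid\mathbf{X})\big)/\mathbb{E}_{\theta^*}(|S|)$, with $0/0=0$. Plug-in procedure at level $\alpha$ based on an estimator $\hat\theta=\hat\theta(\mathbf{X})\in\Theta$: $\hat Z_i^{\rm PI}\in\arg\max_q\ell_q(X_i,\hat\theta)$; $\hat T_i=T(X_i,\hat\theta)$ with order statistics $\hat T_{(1)}\le\dots\le\hat T_{(n)}$; $\hat k$ is the maximum of the $k\in\{0,\dots,n\}$ with $\max(k,1)^{-1}\sum_{j=1}^k\hat T_{(j)}\le\alpha$; $\widehat S_\alpha^{\rm PI}$ is the set of indices of the $\hat k$ smallest $\hat T_i$'s. Permuted parameter: for $\sigma\in[Q]$, $\theta^\sigma$ is $\theta$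 with classes relabelled by $\sigma$, i.e. $\theta^\sigma=((\pi_{\sigma(q)})_q,(\phi_{\sigma(q)})_q)$. Critical levels: $\mathrm{mFMR}^*_t=\mathbb{E}_{\theta^*}(T(X,\theta^* )\mid T(X,\theta^* )<t)$ (equal to $0$ if the conditioning event has probability $0$), $\alpha_c=\inf\{\mathrm{mFMR}^*_t: t\in(0,1],\mathrm{mFMR}^*_t>0\}$, $\bar\alpha=\mathrm{mFMR}^*_1$. VC dimensions: the VC dimension of a set $\mathscr{F}$ of real functions on $\mathbb{R}^d$ is that of the set family $\{\{x:f(x)\ge u\},f\in\mathscr{F},u\in\mathbb{R}\}$. $\mathscr{V}$ is the VC dimension of $\{\ell_q(\cdot,\theta),\theta\in\Theta,1\le q\le Q\}$, and $\mathscr{V}_-$ is that of $\{\mathbf{1}\{\ell_q(\cdot,\theta)-\ell_{q'}(\cdot,\theta)\ge0\},\theta\in\Theta,1\le q,q'\le Q\}$. *)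

theory Defs
  imports "HOL-Probability.Probability" "HOL-Combinatorics.Permutations"
begin

text \<open>
  Class labels range over a finite type \<open>'q\<close>, so the number of classes is \<open>CARD('q)\<close>.
  A parameter is the pair of its proportions and its component parameters; \<open>norm\<close> on this product
  type is the Euclidean norm of all coordinates. As the proportions sum to \<open>1\<close>, a nonempty set of parameters
  is never open in this type; that it is an open subset of some \<open>\<real>\<^sup>K\<close> means that it is homeomorphic to
  one (for example by dropping one proportion and other redundant coordinates).
\<close>

type_synonym ('q, 'u) param = "(real ^ 'q) \<times> ('u ^ 'q)"

definition valid_params :: "'u set \<Rightarrow> ('q::finite, 'u) param set" where
  "valid_params U = {(p, \<phi>). (\<forall>q. 0 < p $ q) \<and> (\<Sum>q\<in>UNIV. p $ q) = 1 \<and>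
     (\<forall>q. \<phi> $ q \<in> U) \<and> inj (\<lambda>q. \<phi> $ q)}"

definition density_family ::
  "'u set \<Rightarrow> ('u \<Rightarrow> (real ^ 'd) measure) \<Rightarrow> ('u \<Rightarrow> real ^ 'd \<Rightarrow> real) \<Rightarrow> bool" where
  "density_family U F f \<longleftrightarrow> (\<forall>u\<in>U. prob_space (F u) \<and>
     f u \<in> borel_measurable borel \<and> (\<forall>x. 0 \<le> f u x) \<and>
     F u = density lborel (\<lambda>x. ennreal (f u x)))"

text \<open>The law of \<open>(Z, X)\<close>: draw the label \<open>q\<close>, then draw the observation from \<open>F \<phi>\<^sub>q\<close>.\<close>

definition mix_law ::
  "('u \<Rightarrow> (real ^ 'd) measure) \<Rightarrow> ('q::finite, 'u) param \<Rightarrow> ('q \<times> (real ^ 'd)) measure" where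
  "mix_law F \<theta> = point_measure UNIV (\<lambda>q. ennreal (fst \<theta> $ q)) \<bind>
     (\<lambda>q. distr (F (snd \<theta> $ q)) (count_space UNIV \<Otimes>\<^sub>M borel) (Pair q))"

lemma emeasure_mix_law:
  fixes F :: "'u \<Rightarrow> (real ^ 'd) measure" and \<theta> :: "('q::finite, 'u) param"
  assumes fam: "density_family U F f" and th: "\<theta> \<in> valid_params U"
    and B: "B \<in> sets (borel :: (real ^ 'd) measure)"
  shows "emeasure (mix_law F \<theta>) ({q} \<times> B) = ennreal (fst \<theta> $ q) * emeasure (F (snd \<theta> $ q)) B"
proof -
  let ?N = "count_space UNIV \<Otimes>\<^sub>M borel :: ('q \<times> (real ^ 'd)) measure"
  have ps: "prob_space (F (snd \<theta> $ l))" and sF: "sets (F (snd \<theta> $ l)) = sets borel" for l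
    using fam th by (auto simp: density_family_def valid_params_def)
  have m: "Pair l \<in> F (snd \<theta> $ l) \<rightarrow>\<^sub>M ?N" for l
    unfolding measurable_cong_sets[OF sF refl] by measurable
  have k: "(\<lambda>l. distr (F (snd \<theta> $ l)) ?N (Pair l)) \<in>
      point_measure UNIV (\<lambda>q. ennreal (fst \<theta> $ q)) \<rightarrow>\<^sub>M subprob_algebra ?N"
    by (auto simp: space_subprob_algebra
        intro!: prob_space_imp_subprob_space prob_space.prob_space_distr[OF ps m])
  have q: "{q} \<times> B \<in> sets ?N" using B by auto
  have "emeasure (mix_law F \<theta>) ({q} \<times> B) =
      (\<Sum>l\<in>UNIV. ennreal (fst \<theta> $ l) * emeasure (distr (F (snd \<theta> $ l)) ?N (Pair l)) ({q} \<times> B))"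
    unfolding mix_law_def
    by (subst emeasure_bind[OF _ k q]) (simp_all add: space_point_measure nn_integral_point_measure_finite)
  also have "\<dots> = (\<Sum>l\<in>UNIV. if l = q then ennreal (fst \<theta> $ q) * emeasure (F (snd \<theta> $ q)) B else 0)"
  proof (rule sum.cong[OF refl])
    fix l
    have "Pair l -` ({q} \<times> B) \<inter> space (F (snd \<theta> $ l)) = (if l = q then B else {})"
      using sets_eq_imp_space_eq[OF sF[of l]] by auto
    then show "ennreal (fst \<theta> $ l) * emeasure (distr (F (snd \<theta> $ l)) ?N (Pair l)) ({q} \<times> B) =
      (if l = q then ennreal (fst \<theta> $ q) * emeasure (F (snd \<theta> $ q)) B else 0)"
      by (simp add: emeasure_distr[OF m q])
  qed
  finally show ?thesis by simp
qed

definition obs_law ::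
  "('u \<Rightarrow> (real ^ 'd) measure) \<Rightarrow> ('q::finite, 'u) param \<Rightarrow> (real ^ 'd) measure" where
  "obs_law F \<theta> = distr (mix_law F \<theta>) borel snd"

definition permuted :: "('q \<Rightarrow> 'q) \<Rightarrow> ('q::finite, 'u) param \<Rightarrow> ('q, 'u) param" where
  "permuted \<sigma> \<theta> = ((\<chi> q. fst \<theta> $ \<sigma> q), (\<chi> q. snd \<theta> $ \<sigma> q))"

text \<open>Where all weighted densities vanish, the quotient is \<open>0 / 0 = 0\<close>.\<close>

definition post ::
  "('u \<Rightarrow> real ^ 'd \<Rightarrow> real) \<Rightarrow> 'q \<Rightarrow> real ^ 'd \<Rightarrow> ('q::finite, 'u) param \<Rightarrow> real" where
  "post f q x \<theta> =
     fst \<theta> $ q * f (snd \<theta> $ q) x / (\<Sum>l\<in>UNIV. fst \<theta> $ l * f (snd \<theta> $ l) x)"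

definition Tstat ::
  "('u \<Rightarrow> real ^ 'd \<Rightarrow> real) \<Rightarrow> real ^ 'd \<Rightarrow> ('q::finite, 'u) param \<Rightarrow> real" where
  "Tstat f x \<theta> = 1 - (MAX q\<in>UNIV. post f q x \<theta>)"

text \<open>The conditional expectation given an event; division by \<open>0\<close> gives \<open>0\<close> on a null event.\<close>

definition mFMR_star ::
  "('u \<Rightarrow> (real ^ 'd) measure) \<Rightarrow> ('u \<Rightarrow> real ^ 'd \<Rightarrow> real) \<Rightarrow> ('q::finite, 'u) param \<Rightarrow> real \<Rightarrow> real"
where
  "mFMR_star F f \<theta> t =
     (LINT x:{x. Tstat f x \<theta> < t}|obs_law F \<theta>. Tstat f x \<theta>) /
     measure (obs_law F \<theta>) {x. Tstat f x \<theta> < t}"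

definition alpha_crit ::
  "('u \<Rightarrow> (real ^ 'd) measure) \<Rightarrow> ('u \<Rightarrow> real ^ 'd \<Rightarrow> real) \<Rightarrow> ('q::finite, 'u) param \<Rightarrow> real" where
  "alpha_crit F f \<theta> = Inf {mFMR_star F f \<theta> t |t. t \<in> {0<..1} \<and> mFMR_star F f \<theta> t > 0}"

definition alpha_bar ::
  "('u \<Rightarrow> (real ^ 'd) measure) \<Rightarrow> ('u \<Rightarrow> real ^ 'd \<Rightarrow> real) \<Rightarrow> ('q::finite, 'u) param \<Rightarrow> real" where
  "alpha_bar F f \<theta> = mFMR_star F f \<theta> 1"

definition shatters :: "'x set set \<Rightarrow> 'x set \<Rightarrow> bool" where
  "shatters \<A> S \<longleftrightarrow> (\<forall>B\<subseteq>S. \<exists>A\<in>\<A>. A \<inter> S = B)"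

definition vc_dim_sets :: "'x set set \<Rightarrow> enat" where
  "vc_dim_sets \<A> = Sup {enat (card S) |S. finite S \<and> shatters \<A> S}"

definition vc_dim :: "('x \<Rightarrow> real) set \<Rightarrow> enat" where
  "vc_dim \<F> = vc_dim_sets {{x. f x \<ge> u} |f u. f \<in> \<F>}"

text \<open>
  A data vector of size \<open>n\<close> is a function on the index set \<open>{1..n}\<close>. A procedure is the pair of its
  label assignment and its selected set, as functions of the data vector.
\<close>

abbreviation data_space :: "nat \<Rightarrow> (nat \<Rightarrow> real ^ 'd) measure" where
  "data_space n \<equiv> (\<Pi>\<^sub>M i\<in>{1..n}. borel)"

definition data :: "(nat \<Rightarrow> 'w \<Rightarrow> real ^ 'd) \<Rightarrow> nat \<Rightarrow> 'w \<Rightarrow> (nat \<Rightarrow> real ^ 'd)" where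
  "data X n \<omega> = (\<lambda>i\<in>{1..n}. X i \<omega>)"

type_synonym ('q, 'd) proc =
  "((nat \<Rightarrow> real ^ 'd) \<Rightarrow> nat \<Rightarrow> 'q) \<times> ((nat \<Rightarrow> real ^ 'd) \<Rightarrow> nat set)"

definition procedure :: "nat \<Rightarrow> ('q, 'd::finite) proc \<Rightarrow> bool" where
  "procedure n C \<longleftrightarrow>
     (\<forall>i\<in>{1..n}. (\<lambda>x. fst C x i) \<in> data_space n \<rightarrow>\<^sub>M count_space UNIV) \<and>
     snd C \<in> data_space n \<rightarrow>\<^sub>M count_space (Pow {1..n})"

definition clust_err :: "nat set \<Rightarrow> (nat \<Rightarrow> 'q) \<Rightarrow> (nat \<Rightarrow> 'q) \<Rightarrow> real" where
  "clust_err S zh z = (\<Sum>i\<in>S. of_bool (z i \<noteq> zh i))"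

definition cond_exp_data ::
  "'w measure \<Rightarrow> (nat \<Rightarrow> 'w \<Rightarrow> real ^ 'd) \<Rightarrow> nat \<Rightarrow> ('w \<Rightarrow> real) \<Rightarrow> 'w \<Rightarrow> real" where
  "cond_exp_data M X n = real_cond_exp M (vimage_algebra (space M) (data X n) (data_space n))"

definition exp_selected ::
  "'w measure \<Rightarrow> (nat \<Rightarrow> 'w \<Rightarrow> real ^ 'd) \<Rightarrow> nat \<Rightarrow> ('q, 'd) proc \<Rightarrow> real" where
  "exp_selected M X n C = (LINT \<omega>|M. real (card (snd C (data X n \<omega>))))"

definition FMR ::
  "'w measure \<Rightarrow> (nat \<Rightarrow> 'w \<Rightarrow> 'q) \<Rightarrow> (nat \<Rightarrow> 'w \<Rightarrow> real ^ 'd) \<Rightarrow> nat \<Rightarrow> ('q, 'd) proc \<Rightarrow> real" where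
  "FMR M Z X n C =
     (LINT \<omega>|M. (MIN \<sigma>\<in>{\<sigma>. \<sigma> permutes UNIV}. cond_exp_data M X n
        (\<lambda>w. clust_err (snd C (data X n w)) (\<lambda>i. \<sigma> (fst C (data X n w) i)) (\<lambda>i. Z i w)
              / real (max (card (snd C (data X n w))) 1)) \<omega>))"

definition mFMR ::
  "'w measure \<Rightarrow> (nat \<Rightarrow> 'w \<Rightarrow> 'q) \<Rightarrow> (nat \<Rightarrow> 'w \<Rightarrow> real ^ 'd) \<Rightarrow> nat \<Rightarrow> ('q, 'd) proc \<Rightarrow> real" where
  "mFMR M Z X n C =
     (LINT \<omega>|M. (MIN \<sigma>\<in>{\<sigma>. \<sigma> permutes UNIV}. cond_exp_data M X n
        (\<lambda>w. clust_err (snd C (data X n w)) (\<lambda>i. \<sigma> (fst C (data X n w) i)) (\<lambda>i. Z i w)) \<omega>))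
     / exp_selected M X n C"

definition order_stat :: "nat \<Rightarrow> (nat \<Rightarrow> real) \<Rightarrow> nat \<Rightarrow> real" where
  "order_stat n t j = sort (map t [1..<Suc n]) ! (j - 1)"

definition khat :: "real \<Rightarrow> nat \<Rightarrow> (nat \<Rightarrow> real) \<Rightarrow> nat" where
  "khat \<alpha> n t = Max {k \<in> {0..n}. (\<Sum>j=1..k. order_stat n t j) / real (max k 1) \<le> \<alpha>}"

text \<open>
  The arg max and the indices of the \<open>khat\<close> smallest statistics need not be unique: this predicate
  holds for every way of breaking the ties.
\<close>

definition is_plugin ::
  "('u \<Rightarrow> real ^ 'd \<Rightarrow> real) \<Rightarrow> real \<Rightarrow> nat \<Rightarrow> ((nat \<Rightarrow> real ^ 'd) \<Rightarrow> ('q::finite, 'u) param)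
     \<Rightarrow> ('q, 'd) proc \<Rightarrow> bool" where
  "is_plugin f \<alpha> n th C \<longleftrightarrow> (\<forall>x\<in>space (data_space n).
     (\<forall>i\<in>{1..n}. is_arg_max (\<lambda>q. post f q (x i) (th x)) (\<lambda>_. True) (fst C x i)) \<and>
     snd C x \<subseteq> {1..n} \<and>
     card (snd C x) = khat \<alpha> n (\<lambda>i. Tstat f (x i) (th x)) \<and>
     (\<forall>i\<in>snd C x. \<forall>j\<in>{1..n} - snd C x. Tstat f (x i) (th x) \<le> Tstat f (x j) (th x)))"

end

theory Submission
  imports Defs
begin

text \<open>
  The estimator has countable range and is consistent up to relabelling, and the posterior
  probabilities are continuous in the parameter. Hence with probability tending to \<open>1\<close> the estimated
  and the true posterior probabilities differ (after relabelling) by at most an envelope of small mean,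
  and the average of the envelope over the sample has the same small mean.

  The plug-in selection is the largest one whose mean estimated error is at most \<open>\<alpha>\<close>, so it is at
  least as large as every selection \<open>{i. T\<^sub>i < t}\<close> with mean excess \<open>E ((T - \<alpha>) 1{T < t}) < 0\<close>; its
  misclassification rate is at most \<open>\<alpha>\<close> plus the average envelope divided by the selected proportion.
  
  Conversely, let \<open>t\<^sup>*\<close> be the first threshold at which the mean excess reaches \<open>0\<close>. A Lagrangian
  (Neyman-Pearson) argument shows that no procedure of marginal rate at most \<open>\<alpha>\<close> selects a larger
  proportion than \<open>P (T < t\<^sup>*)\<close>.
\<close>

text \<open>The estimator is computed from the very sample that it classifies, so the estimated
  statistics of different indices are dependent and their sums are not sums of independent terms.
  Replacing each estimated statistic by the true one plus an envelope value removes the estimator: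
  what remains are sums of one fixed bounded function of independent observations. Their means are
  exact, and a negative mean makes a positive sum exponentially unlikely. The price is the mean of
  the envelope, which has to be absorbed by strict inequalities. This is why the plug-in rule is
  compared with thresholds strictly below the oracle threshold, where the mean excess is negative
  with room to spare, while competitors are bounded at the oracle threshold itself; continuity of
  the distribution function of \<open>T\<close> closes the gap. The radius of the envelope is fixed
  before the sample size grows. The minimum over permutations is harmless on both sides: the
  estimator supplies one admissible permutation, and the lower bound for competitors is free of the
  permutation.\<close>

lemma limsup_ereal_leI:
  assumes "\<And>e. 0 < e \<Longrightarrow> eventually (\<lambda>n. u n \<le> a + e) sequentially"
  shows "limsup (\<lambda>n. ereal (u n)) \<le> ereal a"
  unfolding Limsup_le_iff
proof (intro allI impI)
  fix y assume "ereal a < y"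
  then obtain b where b: "ereal a < ereal b" "ereal b < y" using ereal_dense2 by blast
  show "eventually (\<lambda>n. ereal (u n) < y) sequentially"
    using assms[of "b - a"] b
    by (auto elim!: eventually_mono intro: le_less_trans[of _ "ereal b"])
qed

lemma liminf_ereal_geI:
  assumes "\<And>e. 0 < e \<Longrightarrow> eventually (\<lambda>n. a - e \<le> u n) sequentially"
  shows "ereal a \<le> liminf (\<lambda>n. ereal (u n))"
  unfolding le_Liminf_iff
proof (intro allI impI)
  fix y assume "y < ereal a"
  then obtain b where b: "y < ereal b" "ereal b < ereal a" using ereal_dense2 by blast
  show "eventually (\<lambda>n. y < ereal (u n)) sequentially"
    using assms[of "a - b"] b
    by (auto elim!: eventually_mono intro: less_le_trans[of _ "ereal b"])
qed

section \<open>Order statistics\<close>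

text \<open>Exchange argument: the common part of \<open>S\<close> and \<open>A\<close> cancels, the
  two differences have equal size, and the largest value on \<open>S - A\<close> is at most every
  value on \<open>A - S\<close>.\<close>

lemma sum_le_sum_of_card_eq:
  fixes t :: "'a \<Rightarrow> real"
  assumes fin: "finite S" "finite A" and card: "card S = card A"
    and le: "\<And>i j. i \<in> S \<Longrightarrow> j \<in> A - S \<Longrightarrow> t i \<le> t j"
  shows "sum t S \<le> sum t A"
proof -
  have eq: "card (S - A) = card (A - S)"
    using card card_Diff_subset_Int[of S A] card_Diff_subset_Int[of A S] fin
    by (simp add: Int_commute)
  have "sum t (S - A) \<le> sum t (A - S)"
  proof (cases "S - A = {}")
    case True
    then have "card (A - S) = 0" using eq by (simp only: card.empty)
    then have "A - S = {}" using fin(2) by (metis card_0_eq finite_Diff)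
    with True show ?thesis by (simp only: order_refl)
  next
    case False
    define m where "m = Max (t ` (S - A))"
    have "sum t (S - A) \<le> real (card (S - A)) * m"
      using fin by (intro sum_bounded_above) (auto simp: m_def)
    also have "\<dots> = real (card (A - S)) * m" by (simp add: eq)
    also have "m \<in> t ` (S - A)" unfolding m_def using fin False by (intro Max_in) auto
    then have "real (card (A - S)) * m \<le> sum t (A - S)"
      using le by (intro sum_bounded_below) auto
    finally show ?thesis .
  qed
  moreover have "sum t S = sum t (S - A) + sum t (S \<inter> A)"
    using sum.Int_Diff[OF fin(1), of t A] by (simp add: add.commute)
  moreover have "sum t A = sum t (A - S) + sum t (S \<inter> A)"
    using sum.Int_Diff[OF fin(2), of t S] by (simp add: add.commute Int_commute)
  ultimately show ?thesis by simp
qed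

text \<open>Sorting the indices by their values, rather than the values themselves, keeps track of
  where an order statistic comes from. Sums of order statistics thus become sums over index sets,
  where the exchange argument applies.\<close>

lemma order_stat_bij:
  obtains p where "bij_betw p {1..n} {1..n}" "\<And>j. j \<in> {1..n} \<Longrightarrow> order_stat n t j = t (p j)"
    "\<And>i j. 1 \<le> i \<Longrightarrow> i \<le> j \<Longrightarrow> j \<le> n \<Longrightarrow> t (p i) \<le> t (p j)"
proof -
  define xs where "xs = sort_key t [1..<Suc n]"
  have len: "length xs = n" by (simp add: xs_def)
  have sorted: "sorted (map t xs)" by (simp add: xs_def)
  \<comment> \<open>A sorted list is determined by the multiset of its entries, so sorting the
    values or the indices gives the same list of values.\<close>
  have "sort (map t [1..<Suc n]) = map t xs"
    by (rule properties_for_sort[OF _ sorted]) (simp add: xs_def del: upt_Suc)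
  then have os: "order_stat n t j = t (xs ! (j - 1))" if "j \<in> {1..n}" for j
    using that len by (auto simp: order_stat_def simp del: upt_Suc)
  \<comment> \<open>The shift by one links list positions, counted from \<open>0\<close>, with order
    statistics, counted from \<open>1\<close>.\<close>
  have "bij_betw (\<lambda>j. xs ! (j - 1)) {1..n} {1..n}"
  proof (rule bij_betw_trans[of "\<lambda>j. j - 1" "{1..n}" "{..<n}" "(!) xs", unfolded comp_def])
    show "bij_betw (\<lambda>j. j - 1) {1..n} {..<n}"
      by (rule bij_betw_byWitness[where f' = Suc]) auto
    have "distinct xs" "set xs = {1..n}" by (auto simp: xs_def simp del: upt_Suc)
    then show "bij_betw ((!) xs) {..<n} {1..n}"
      by (metis bij_betw_nth len)
  qed
  moreover have "t (xs ! (i - 1)) \<le> t (xs ! (j - 1))" if "1 \<le> i" "i \<le> j" "j \<le> n" for i j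
    using sorted_nth_mono[OF sorted, of "i - 1" "j - 1"] that len by simp
  ultimately show thesis using os that[of "\<lambda>j. xs ! (j - 1)"] by blast
qed

text \<open>The first \<open>card A\<close> order statistics sit on the image of an initial segment
  of positions, and every index outside this image has a later position. The image competes with
  \<open>A\<close> in the exchange argument.\<close>

lemma sum_order_stat_le:
  assumes "A \<subseteq> {1..n}"
  shows "(\<Sum>j=1..card A. order_stat n t j) \<le> sum t A"
proof -
  obtain p where p: "bij_betw p {1..n} {1..n}" "\<And>j. j \<in> {1..n} \<Longrightarrow> order_stat n t j = t (p j)"
    "\<And>i j. 1 \<le> i \<Longrightarrow> i \<le> j \<Longrightarrow> j \<le> n \<Longrightarrow> t (p i) \<le> t (p j)"
    by (rule order_stat_bij[of n t]) blast
  let ?k = "card A"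
  have k: "?k \<le> n" using card_mono[OF _ assms] by simp
  then have inj: "inj_on p {1..?k}"
    using p(1) by (auto simp: bij_betw_def intro: inj_on_subset)
  have "(\<Sum>j=1..?k. order_stat n t j) = (\<Sum>j=1..?k. t (p j))"
    using k p(2) by (intro sum.cong) auto
  also have "\<dots> = sum t (p ` {1..?k})" using inj by (simp add: sum.reindex)
  also have "\<dots> \<le> sum t A"
  proof (rule sum_le_sum_of_card_eq)
    show "finite A" using assms finite_subset by blast
    show "card (p ` {1..?k}) = card A" using inj by (simp add: card_image)
    fix i j assume "i \<in> p ` {1..?k}" "j \<in> A - p ` {1..?k}"
    moreover have "A \<subseteq> p ` {1..n}" using assms p(1) by (simp add: bij_betw_def)
    ultimately obtain a b where ab: "i = p a" "j = p b" "a \<in> {1..?k}" "b \<in> {1..n}" "b \<notin> {1..?k}"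
      by blast
    then show "t i \<le> t j" using p(3)[of a b] by auto
  qed simp
  finally show ?thesis .
qed

text \<open>Connects the selection rule, which leaves ties open, with the sum that defines
  \<open>khat\<close>: however ties are broken, the exchange argument works in both
  directions.\<close>

lemma sum_smallest_eq_order_stat:
  assumes S: "S \<subseteq> {1..n}" and le: "\<And>i j. i \<in> S \<Longrightarrow> j \<in> {1..n} - S \<Longrightarrow> t i \<le> t j"
  shows "sum t S = (\<Sum>j=1..card S. order_stat n t j)"
proof (rule antisym)
  obtain p where p: "bij_betw p {1..n} {1..n}" "\<And>j. j \<in> {1..n} \<Longrightarrow> order_stat n t j = t (p j)"
    by (rule order_stat_bij[of n t]) blast
  let ?k = "card S"
  have k: "?k \<le> n" using card_mono[OF _ S] by simp
  then have inj: "inj_on p {1..?k}"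
    using p(1) by (auto simp: bij_betw_def intro: inj_on_subset)
  have sub: "p ` {1..?k} \<subseteq> {1..n}" using p(1) k by (auto simp: bij_betw_def)
  have "sum t S \<le> sum t (p ` {1..?k})"
    using le sub inj S by (intro sum_le_sum_of_card_eq) (auto simp: card_image intro: finite_subset)
  also have "\<dots> = (\<Sum>j=1..?k. t (p j))" using inj by (simp add: sum.reindex)
  also have "\<dots> = (\<Sum>j=1..?k. order_stat n t j)" using k p(2) by (intro sum.cong) auto
  finally show "sum t S \<le> (\<Sum>j=1..?k. order_stat n t j)" .
qed (rule sum_order_stat_le[OF S])

text \<open>Lower bounds on the size of the selection come from here: a set with mean statistic at
  most \<alpha> makes its cardinality feasible in \<open>khat\<close>, because the equally many
  smallest values have no larger sum.\<close>

lemma khat_ge: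
  assumes "A \<subseteq> {1..n}" "sum t A \<le> \<alpha> * real (card A)" "0 \<le> \<alpha>"
  shows "card A \<le> khat \<alpha> n t"
proof -
  have "card A \<le> n" using card_mono[OF _ assms(1)] by simp
  moreover have "(\<Sum>j=1..card A. order_stat n t j) / real (max (card A) 1) \<le> \<alpha>"
  proof (cases "card A = 0")
    case False
    have "(\<Sum>j=1..card A. order_stat n t j) \<le> \<alpha> * real (card A)"
      using sum_order_stat_le[OF assms(1)] assms(2) by (rule order_trans)
    moreover have "max (card A) 1 = card A" using False by simp
    ultimately show ?thesis using False by (simp add: divide_le_eq)
  qed (use assms in simp)
  ultimately show ?thesis unfolding khat_def by (intro Max_ge) auto
qed

text \<open>As \<alpha> is nonnegative, \<open>k = 0\<close> is always feasible, so the maximum in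
  \<open>khat\<close> is attained and satisfies its own constraint.\<close>

lemma sum_order_stat_khat_le:
  assumes "0 \<le> \<alpha>"
  shows "(\<Sum>j=1..khat \<alpha> n t. order_stat n t j) \<le> \<alpha> * real (khat \<alpha> n t)"
proof -
  let ?K = "{k \<in> {0..n}. (\<Sum>j=1..k. order_stat n t j) / real (max k 1) \<le> \<alpha>}"
  have "0 \<in> ?K" using assms by simp
  then have "khat \<alpha> n t \<in> ?K" unfolding khat_def by (intro Max_in) (auto simp del: mem_Collect_eq)
  then have le: "(\<Sum>j=1..khat \<alpha> n t. order_stat n t j) / real (max (khat \<alpha> n t) 1) \<le> \<alpha>" by simp
  show ?thesis
  proof (cases "khat \<alpha> n t = 0")
    case False
    then have "max (khat \<alpha> n t) 1 = khat \<alpha> n t" by simp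
    then show ?thesis using le False by (simp add: divide_le_eq)
  qed simp
qed

section \<open>Posterior probabilities\<close>

lemma post_bounds:
  assumes "\<forall>u\<in>U. \<forall>x. 0 \<le> f u x" and "\<theta> \<in> valid_params U"
  shows "0 \<le> post f q x \<theta>" "post f q x \<theta> \<le> 1"
proof -
  have nn: "0 \<le> fst \<theta> $ l * f (snd \<theta> $ l) x" for l
  proof -
    have "0 < fst \<theta> $ l" "snd \<theta> $ l \<in> U" using assms(2) by (auto simp: valid_params_def)
    then show ?thesis using assms(1) by simp
  qed
  show "0 \<le> post f q x \<theta>" unfolding post_def using nn by (intro divide_nonneg_nonneg sum_nonneg) auto
  have "fst \<theta> $ q * f (snd \<theta> $ q) x \<le> (\<Sum>l\<in>UNIV. fst \<theta> $ l * f (snd \<theta> $ l) x)"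
    using nn by (intro member_le_sum) auto
  then show "post f q x \<theta> \<le> 1" unfolding post_def
    using nn[of q] by (simp add: divide_le_eq_1) linarith
qed

lemma sum_post_eq_1:
  assumes "(\<Sum>l\<in>UNIV. fst \<theta> $ l * f (snd \<theta> $ l) x) \<noteq> 0"
  shows "(\<Sum>q\<in>UNIV. post f q x \<theta>) = 1"
  unfolding post_def using assms by (simp flip: sum_divide_distrib)

lemma post_permuted:
  assumes "\<sigma> permutes UNIV"
  shows "post f q x (permuted \<sigma> \<theta>) = post f (\<sigma> q) x \<theta>"
proof -
  have "bij \<sigma>" using assms by (rule permutes_bij)
  then have "(\<Sum>l\<in>UNIV. fst \<theta> $ \<sigma> l * f (snd \<theta> $ \<sigma> l) x) = (\<Sum>l\<in>UNIV. fst \<theta> $ l * f (snd \<theta> $ l) x)"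
    by (rule sum.reindex_bij_betw)
  then show ?thesis by (simp add: post_def permuted_def)
qed

lemma permuted_valid:
  assumes "\<sigma> permutes UNIV" "\<theta> \<in> valid_params U"
  shows "permuted \<sigma> \<theta> \<in> valid_params U"
proof -
  have b: "bij \<sigma>" using assms(1) by (rule permutes_bij)
  then have "(\<Sum>l\<in>UNIV. fst \<theta> $ \<sigma> l) = (\<Sum>l\<in>UNIV. fst \<theta> $ l)"
    by (rule sum.reindex_bij_betw)
  moreover have "inj (\<lambda>q. snd \<theta> $ \<sigma> q)"
    using assms(2) b inj_compose[of "\<lambda>q. snd \<theta> $ q" \<sigma>]
    by (auto simp: valid_params_def o_def bij_is_inj)
  ultimately show ?thesis using assms(2) by (auto simp: valid_params_def permuted_def inj_def)
qed

lemma Tstat_le: "Tstat f x \<theta> \<le> 1 - post f q x \<theta>"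
  unfolding Tstat_def by simp

lemma Tstat_eq_arg_max:
  assumes "is_arg_max (\<lambda>q. post f q x \<theta>) (\<lambda>_. True) q"
  shows "Tstat f x \<theta> = 1 - post f q x \<theta>"
proof -
  have "(MAX q\<in>UNIV. post f q x \<theta>) = post f q x \<theta>"
    using assms by (intro Max_eqI) (auto simp: is_arg_max_linorder)
  then show ?thesis by (simp add: Tstat_def)
qed

lemma Tstat_permuted:
  assumes "\<sigma> permutes UNIV"
  shows "Tstat f x (permuted \<sigma> \<theta>) = Tstat f x \<theta>"
proof -
  have "range (\<lambda>q. post f (\<sigma> q) x \<theta>) = (\<lambda>q. post f q x \<theta>) ` range \<sigma>" by blast
  then show ?thesis by (simp add: Tstat_def post_permuted[OF assms] permutes_surj[OF assms])
qed

lemma Tstat_bounds: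
  assumes "\<forall>u\<in>U. \<forall>x. 0 \<le> f u x" and "\<theta> \<in> valid_params U"
  shows "0 \<le> Tstat f x \<theta>" "Tstat f x \<theta> \<le> 1"
proof -
  show "0 \<le> Tstat f x \<theta>" unfolding Tstat_def
    using post_bounds(2)[OF assms] by simp
  show "Tstat f x \<theta> \<le> 1"
    using Tstat_le[of f x \<theta> undefined] post_bounds(1)[OF assms, where q=undefined and x=x] by linarith
qed

text \<open>One quantity for both uses of the estimator: it dominates the change of each single
  posterior probability, which governs the labels, and the change of \<open>Tstat\<close>, which
  governs the selection.\<close>

definition post_dist :: "('u \<Rightarrow> real ^ 'd \<Rightarrow> real) \<Rightarrow> real ^ 'd
    \<Rightarrow> ('q::finite, 'u) param \<Rightarrow> ('q, 'u) param \<Rightarrow> real" where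
  "post_dist f x \<theta> \<theta>' = (\<Sum>q\<in>UNIV. \<bar>post f q x \<theta> - post f q x \<theta>'\<bar>)"

lemma abs_post_diff_le: "\<bar>post f q x \<theta> - post f q x \<theta>'\<bar> \<le> post_dist f x \<theta> \<theta>'"
  unfolding post_dist_def by (rule member_le_sum) auto

text \<open>The label that is best for \<open>\<theta>'\<close> is a candidate for \<theta>, and its
  posterior probability differs by at most \<open>post_dist\<close>.\<close>

lemma Tstat_diff_le: "Tstat f x \<theta> \<le> Tstat f x \<theta>' + post_dist f x \<theta> \<theta>'"
proof -
  have "(MAX q\<in>UNIV. post f q x \<theta>') \<in> range (\<lambda>q. post f q x \<theta>')" by (intro Max_in) auto
  then obtain q where "(MAX q\<in>UNIV. post f q x \<theta>') = post f q x \<theta>'" by blast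
  then have "Tstat f x \<theta>' = 1 - post f q x \<theta>'" by (simp add: Tstat_def)
  then show ?thesis using Tstat_le[of f x \<theta> q] abs_post_diff_le[of f q x \<theta> \<theta>'] by linarith
qed

text \<open>Numerator and denominator of \<open>post\<close> are continuous on
  \<open>valid_params U\<close>, and \<open>nz\<close> keeps the limit away from the convention
  \<open>0 / 0 = 0\<close>. The limit is taken within the valid parameters because the densities are
  continuous in the parameter on \<open>U\<close>.\<close>

lemma post_dist_tendsto_0:
  fixes \<theta>s :: "('q::finite, 'u::euclidean_space) param"
  assumes cont: "continuous_on U (\<lambda>u. f u x)" and th: "\<theta>s \<in> valid_params U"
    and nz: "(\<Sum>l\<in>UNIV. fst \<theta>s $ l * f (snd \<theta>s $ l) x) \<noteq> 0"
  shows "((\<lambda>\<theta>. post_dist f x \<theta> \<theta>s) \<longlongrightarrow> 0) (at \<theta>s within valid_params U)"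
proof -
  have "continuous_on (valid_params U) (\<lambda>\<theta> :: ('q, 'u) param. fst \<theta> $ l * f (snd \<theta> $ l) x)" for l
    by (intro continuous_intros continuous_on_compose2[OF cont]) (auto simp: valid_params_def)
  then have *: "((\<lambda>\<theta>. fst \<theta> $ l * f (snd \<theta> $ l) x) \<longlongrightarrow> fst \<theta>s $ l * f (snd \<theta>s $ l) x)
      (at \<theta>s within valid_params U)" for l
    using th unfolding continuous_on_def by blast
  have "((\<lambda>\<theta>. post f q x \<theta>) \<longlongrightarrow> post f q x \<theta>s) (at \<theta>s within valid_params U)" for q
    unfolding post_def by (intro tendsto_divide tendsto_sum * nz)
  then have "((\<lambda>\<theta>. post_dist f x \<theta> \<theta>s) \<longlongrightarrow> (\<Sum>q\<in>(UNIV :: 'q set). \<bar>post f q x \<theta>s - post f q x \<theta>s\<bar>))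
      (at \<theta>s within valid_params U)"
    unfolding post_dist_def by (intro tendsto_intros)
  then show ?thesis by simp
qed

section \<open>Conditional risk in the mixture model\<close>

declare One_nat_def [simp del]

text \<open>Contains the sampling model alone, so that the risk formula derived from it serves the
  plug-in rule and its competitors alike.\<close>

locale mixture_sample = prob_space M for M :: "'w measure" +
  fixes U :: "'u::euclidean_space set"
    and F :: "'u \<Rightarrow> (real ^ 'd) measure"
    and f :: "'u \<Rightarrow> real ^ 'd \<Rightarrow> real"
    and \<theta>s :: "('q::finite, 'u) param"
    and Z :: "nat \<Rightarrow> 'w \<Rightarrow> 'q"
    and X :: "nat \<Rightarrow> 'w \<Rightarrow> real ^ 'd"
  assumes family: "density_family U F f"
    and valid: "\<theta>s \<in> valid_params U"
    and indep: "indep_vars (\<lambda>_. count_space UNIV \<Otimes>\<^sub>M borel) (\<lambda>i \<omega>. (Z i \<omega>, X i \<omega>)) {1..}"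
    and law: "\<And>i. 1 \<le> i \<Longrightarrow>
      distr M (count_space UNIV \<Otimes>\<^sub>M borel) (\<lambda>\<omega>. (Z i \<omega>, X i \<omega>)) = mix_law F \<theta>s"
begin

section \<open>Measurability and bounds of the posterior quantities\<close>

abbreviation "PX \<equiv> obs_law F \<theta>s"

abbreviation "mix_density x \<equiv> \<Sum>l\<in>UNIV. fst \<theta>s $ l * f (snd \<theta>s $ l) x"

lemma f_nonneg: "\<forall>u\<in>U. \<forall>x. 0 \<le> f u x"
  using family by (auto simp: density_family_def)

lemma f_measurable: "u \<in> U \<Longrightarrow> f u \<in> borel_measurable borel"
  using family by (auto simp: density_family_def)

lemma post_measurable [measurable (raw)]:
  assumes "\<theta> \<in> valid_params U"
  shows "(\<lambda>x. post f q x \<theta>) \<in> borel_measurable borel"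
proof -
  have [measurable]: "f (snd \<theta> $ l) \<in> borel_measurable borel" for l
    using assms by (intro f_measurable) (auto simp: valid_params_def)
  show ?thesis unfolding post_def by measurable
qed

lemma Tstat_measurable [measurable (raw)]:
  assumes "\<theta> \<in> valid_params U"
  shows "(\<lambda>x. Tstat f x \<theta>) \<in> borel_measurable borel"
  unfolding Tstat_def by (intro borel_measurable_diff borel_measurable_Max post_measurable[OF assms]) auto

lemma post_dist_measurable [measurable (raw)]:
  assumes "\<theta> \<in> valid_params U" "\<theta>' \<in> valid_params U"
  shows "(\<lambda>x. post_dist f x \<theta> \<theta>') \<in> borel_measurable borel"
  unfolding post_dist_def using post_measurable assms by auto

lemma post_dist_bounds:
  fixes \<theta> \<theta>' :: "('q, 'u) param"
  assumes "\<theta> \<in> valid_params U" "\<theta>' \<in> valid_params U"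
  shows "0 \<le> post_dist f x \<theta> \<theta>'" "post_dist f x \<theta> \<theta>' \<le> real CARD('q)"
proof -
  show "0 \<le> post_dist f x \<theta> \<theta>'" unfolding post_dist_def by (intro sum_nonneg) auto
  have "\<bar>post f q x \<theta> - post f q x \<theta>'\<bar> \<le> 1" for q
    using post_bounds[OF f_nonneg assms(1), of q x] post_bounds[OF f_nonneg assms(2), of q x] by linarith
  then show "post_dist f x \<theta> \<theta>' \<le> real CARD('q)"
    unfolding post_dist_def
    using sum_bounded_above[of "UNIV :: 'q set" "\<lambda>q. \<bar>post f q x \<theta> - post f q x \<theta>'\<bar>" 1] by simp
qed

section \<open>Integration against the mixture law and Bayes' formula\<close>

lemma component_measurable [measurable]: "f (snd \<theta>s $ l) \<in> borel_measurable borel"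
  using valid by (intro f_measurable) (auto simp: valid_params_def)

lemma weighted_density_nonneg: "0 \<le> fst \<theta>s $ l * f (snd \<theta>s $ l) x"
proof -
  have "0 < fst \<theta>s $ l" "snd \<theta>s $ l \<in> U" using valid by (auto simp: valid_params_def)
  then show ?thesis using f_nonneg by simp
qed

lemma weight_pos: "0 < fst \<theta>s $ l"
  using valid by (auto simp: valid_params_def)

lemma component_nonneg: "0 \<le> f (snd \<theta>s $ l) x"
  using valid f_nonneg by (auto simp: valid_params_def)

text \<open>Writing the joint law as a sum of Lebesgue integrals reduces Bayes' formula to an
  identity between integrands.\<close>

lemma nn_integral_mix_law:
  fixes h :: "'q \<times> (real ^ 'd) \<Rightarrow> ennreal"
  assumes h [measurable]: "h \<in> borel_measurable (count_space UNIV \<Otimes>\<^sub>M borel)"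
  shows "(\<integral>\<^sup>+z. h z \<partial>mix_law F \<theta>s) =
    (\<Sum>l\<in>UNIV. \<integral>\<^sup>+x. ennreal (fst \<theta>s $ l * f (snd \<theta>s $ l) x) * h (l, x) \<partial>lborel)"
proof -
  let ?N = "count_space UNIV \<Otimes>\<^sub>M borel :: ('q \<times> (real ^ 'd)) measure"
  have ps: "prob_space (F (snd \<theta>s $ l))" and sF: "sets (F (snd \<theta>s $ l)) = sets borel"
    and dF: "F (snd \<theta>s $ l) = density lborel (\<lambda>x. ennreal (f (snd \<theta>s $ l) x))" for l
    using family valid by (auto simp: density_family_def valid_params_def)
  have m: "Pair l \<in> F (snd \<theta>s $ l) \<rightarrow>\<^sub>M ?N" for l
    unfolding measurable_cong_sets[OF sF refl] by measurable
  have k: "(\<lambda>l. distr (F (snd \<theta>s $ l)) ?N (Pair l)) \<in>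
      point_measure UNIV (\<lambda>q. ennreal (fst \<theta>s $ q)) \<rightarrow>\<^sub>M subprob_algebra ?N"
    by (auto simp: space_subprob_algebra
        intro!: prob_space_imp_subprob_space prob_space.prob_space_distr[OF ps m])
  have "(\<integral>\<^sup>+z. h z \<partial>mix_law F \<theta>s) =
      (\<Sum>l\<in>UNIV. ennreal (fst \<theta>s $ l) * (\<integral>\<^sup>+x. h (l, x) \<partial>F (snd \<theta>s $ l)))"
    unfolding mix_law_def
    by (simp add: nn_integral_bind[OF h k] nn_integral_point_measure_finite nn_integral_distr[OF m])
  also have "\<dots> = (\<Sum>l\<in>UNIV. \<integral>\<^sup>+x. ennreal (fst \<theta>s $ l * f (snd \<theta>s $ l) x) * h (l, x) \<partial>lborel)"
    by (intro sum.cong refl)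
      (simp add: dF nn_integral_density ennreal_mult weight_pos less_imp_le component_nonneg mult.assoc
        flip: nn_integral_cmult)
  finally show ?thesis .
qed

lemma sets_mix_law [simp]: "sets (mix_law F \<theta>s) = sets (count_space UNIV \<Otimes>\<^sub>M borel)"
  unfolding law[OF order_refl, symmetric] by simp

lemma ZX_measurable:
  assumes "1 \<le> i"
  shows "(\<lambda>\<omega>. (Z i \<omega>, X i \<omega>)) \<in> M \<rightarrow>\<^sub>M count_space UNIV \<Otimes>\<^sub>M borel"
  using indep assms by (auto simp: indep_vars_def)

lemma X_measurable:
  assumes "1 \<le> i" shows "X i \<in> borel_measurable M"
  using measurable_compose[OF ZX_measurable[OF assms] measurable_snd] by simp

lemma Z_measurable:
  assumes "1 \<le> i" shows "Z i \<in> M \<rightarrow>\<^sub>M count_space UNIV"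
  using measurable_compose[OF ZX_measurable[OF assms] measurable_fst] by simp

lemma distr_X:
  assumes "1 \<le> i" shows "distr M borel (X i) = PX"
  unfolding obs_law_def law[OF assms, symmetric]
  by (subst distr_distr[OF measurable_snd ZX_measurable[OF assms]]) (simp add: comp_def)

lemma prob_space_PX: "prob_space PX"
  using prob_space_distr[OF X_measurable[of 1]] by (simp add: distr_X)

lemma sets_PX [simp]: "sets PX = sets borel"
  by (simp add: obs_law_def)

lemma space_PX [simp]: "space PX = UNIV"
  by (simp add: obs_law_def)

lemma expectation_X:
  fixes h :: "real ^ 'd \<Rightarrow> real"
  assumes "1 \<le> i" "h \<in> borel_measurable borel"
  shows "expectation (\<lambda>\<omega>. h (X i \<omega>)) = (\<integral>x. h x \<partial>PX)"
  using integral_distr[OF X_measurable[OF assms(1)] assms(2)] by (simp add: distr_X[OF assms(1)])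

text \<open>Where the mixture density vanishes, every weighted density vanishes, so such points
  carry no mass under any component. The convention \<open>0 / 0 = 0\<close> in \<open>post\<close>
  at the true parameter thus concerns a null set.\<close>

lemma AE_mix_density_pos: "AE x in PX. 0 < mix_density x"
proof -
  define A where "A = {x. mix_density x \<le> 0}"
  have A [measurable]: "A \<in> sets borel" unfolding A_def by measurable
  have "emeasure PX A = (\<integral>\<^sup>+x. indicator A x \<partial>PX)" by simp
  also have "\<dots> = (\<integral>\<^sup>+z. indicator A (snd z) \<partial>mix_law F \<theta>s)"
    unfolding obs_law_def
    by (rule nn_integral_distr) (auto simp: measurable_cong_sets[OF sets_mix_law refl])
  also have "\<dots> = 0"
  proof (subst nn_integral_mix_law)
    have *: "fst \<theta>s $ l * f (snd \<theta>s $ l) x = 0" if "x \<in> A" for l x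
    proof -
      have "fst \<theta>s $ l * f (snd \<theta>s $ l) x \<le> mix_density x"
        by (rule member_le_sum) (auto simp: weighted_density_nonneg)
      with that weighted_density_nonneg[of l x] show ?thesis unfolding A_def mem_Collect_eq by linarith
    qed
    have "ennreal (fst \<theta>s $ l * f (snd \<theta>s $ l) x) * indicator A (snd (l, x)) = 0" for l x
      using *[of x l] by (auto simp: indicator_def)
    then show "(\<Sum>l\<in>UNIV. \<integral>\<^sup>+x. ennreal (fst \<theta>s $ l * f (snd \<theta>s $ l) x) *
        indicator A (snd (l, x)) \<partial>lborel) = 0" by (simp only: nn_integral_const sum.neutral_const mult_zero_left)
  qed measurable
  finally have "A \<in> null_sets PX" by (auto intro: null_setsI)
  then show ?thesis by (rule AE_I') (auto simp: A_def not_less)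
qed

text \<open>Bayes' formula in integrated form: the weighted density of label \<open>q\<close> is the
  mixture density times the posterior probability. Both sides are integrals against the joint law,
  so that independence can be used coordinate by coordinate.\<close>

lemma nn_integral_label:
  assumes [measurable]: "B \<in> sets (borel :: (real ^ 'd) measure)"
  shows "(\<integral>\<^sup>+z. indicator {q} (fst z) * indicator B (snd z) \<partial>mix_law F \<theta>s) =
    (\<integral>\<^sup>+z. ennreal (post f q (snd z) \<theta>s) * indicator B (snd z) \<partial>mix_law F \<theta>s)"
proof -
  note [measurable] = post_measurable[OF valid]
  have "(\<integral>\<^sup>+z. indicator {q} (fst z) * indicator B (snd z) \<partial>mix_law F \<theta>s) =
      (\<Sum>l\<in>UNIV. \<integral>\<^sup>+x. ennreal (fst \<theta>s $ l * f (snd \<theta>s $ l) x) * (indicator {q} l * indicator B x) \<partial>lborel)"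
    by (subst nn_integral_mix_law) auto
  also have "\<dots> = (\<Sum>l\<in>UNIV. if l = q then
      (\<integral>\<^sup>+x. ennreal (fst \<theta>s $ q * f (snd \<theta>s $ q) x) * indicator B x \<partial>lborel) else 0)"
    by (intro sum.cong) (auto simp: indicator_def)
  also have "\<dots> = (\<integral>\<^sup>+x. ennreal (fst \<theta>s $ q * f (snd \<theta>s $ q) x) * indicator B x \<partial>lborel)"
    by simp
  also have "\<dots> = (\<integral>\<^sup>+x. (\<Sum>l\<in>UNIV. ennreal (fst \<theta>s $ l * f (snd \<theta>s $ l) x) *
      (ennreal (post f q x \<theta>s) * indicator B x)) \<partial>lborel)"
  proof (rule nn_integral_cong)
    fix x
    \<comment> \<open>If the mixture density is \<open>0\<close>, each of its nonnegative summands
      is \<open>0\<close>, and the identity reads \<open>0 = 0\<close>.\<close>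
    have "fst \<theta>s $ q * f (snd \<theta>s $ q) x = mix_density x * post f q x \<theta>s"
    proof (cases "mix_density x = 0")
      case True
      then have "fst \<theta>s $ q * f (snd \<theta>s $ q) x = 0"
        using sum_nonneg_eq_0_iff[of UNIV "\<lambda>l. fst \<theta>s $ l * f (snd \<theta>s $ l) x"]
        by (simp add: weighted_density_nonneg)
      with True show ?thesis by simp
    qed (simp add: post_def)
    then show "ennreal (fst \<theta>s $ q * f (snd \<theta>s $ q) x) * indicator B x =
        (\<Sum>l\<in>UNIV. ennreal (fst \<theta>s $ l * f (snd \<theta>s $ l) x) * (ennreal (post f q x \<theta>s) * indicator B x))"
      by (simp add: sum_nonneg weighted_density_nonneg ennreal_mult' post_bounds[OF f_nonneg valid] mult.assoc
          flip: sum_distrib_right)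
  qed
  also have "\<dots> = (\<Sum>l\<in>UNIV. \<integral>\<^sup>+x. ennreal (fst \<theta>s $ l * f (snd \<theta>s $ l) x) *
      (ennreal (post f q x \<theta>s) * indicator B x) \<partial>lborel)"
    by (rule nn_integral_sum) measurable
  also have "\<dots> = (\<integral>\<^sup>+z. ennreal (post f q (snd z) \<theta>s) * indicator B (snd z) \<partial>mix_law F \<theta>s)"
    by (subst nn_integral_mix_law) auto
  finally show ?thesis .
qed

section \<open>Conditioning on the observed sample\<close>

lemma data_measurable [measurable]: "data X n \<in> M \<rightarrow>\<^sub>M data_space n"
  unfolding data_def[abs_def] by (intro measurable_restrict X_measurable) auto

abbreviation "data_algebra n \<equiv> vimage_algebra (space M) (data X n) (data_space n)"

lemma data_algebra: "finite_measure_subalgebra M (data_algebra n)"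
proof
  show "subalgebra M (data_algebra n)"
    unfolding subalgebra_def by (simp add: sets_image_in_sets data_measurable)
qed

lemma data_in_space: "\<omega> \<in> space M \<Longrightarrow> data X n \<omega> \<in> space (data_space n)"
  using measurable_space[OF data_measurable] .

lemma data_measurable_algebra: "data X n \<in> data_algebra n \<rightarrow>\<^sub>M data_space n"
  using data_in_space by (intro measurable_vimage_algebra1) auto

lemma X_measurable_algebra:
  assumes "i \<in> {1..n}" shows "X i \<in> borel_measurable (data_algebra n)"
proof -
  have "(\<lambda>\<omega>. data X n \<omega> i) \<in> borel_measurable (data_algebra n)"
    using measurable_compose[OF data_measurable_algebra measurable_component_singleton[OF assms]] .
  then show ?thesis using assms by (simp add: data_def)
qed

text \<open>As functions of \<open>B\<close> the two sides are measures, which agree on boxes by independence.\<close>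

lemma label_integral_data:
  assumes i: "i \<in> {1..n}" and B: "B \<in> sets (data_space n)"
  shows "(\<integral>\<^sup>+\<omega>. indicator {q} (Z i \<omega>) * indicator B (data X n \<omega>) \<partial>M) =
    (\<integral>\<^sup>+\<omega>. ennreal (post f q (X i \<omega>) \<theta>s) * indicator B (data X n \<omega>) \<partial>M)"
proof -
  note [measurable] = post_measurable[OF valid]
  have i1: "1 \<le> i" using i by simp
  note [measurable] = X_measurable[OF i1] Z_measurable[OF i1]
  \<comment> \<open>The law of the data vector under the weight \<open>a\<close>. The claim amounts
    to equality of two such measures.\<close>
  define P where "P a = distr (density M a) (data_space n) (data X n)" for a :: "'w \<Rightarrow> ennreal"
  have emP: "emeasure (P a) C = (\<integral>\<^sup>+\<omega>. a \<omega> * indicator C (data X n \<omega>) \<partial>M)"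
    if [measurable]: "a \<in> borel_measurable M" "C \<in> sets (data_space n)" for a C
  proof -
    have "emeasure (P a) C = (\<integral>\<^sup>+\<omega>. a \<omega> * indicator (data X n -` C \<inter> space M) \<omega> \<partial>M)"
      unfolding P_def by (subst emeasure_distr) (auto simp: emeasure_density)
    also have "\<dots> = (\<integral>\<^sup>+\<omega>. a \<omega> * indicator C (data X n \<omega>) \<partial>M)"
      by (intro nn_integral_cong) (auto simp: indicator_def)
    finally show ?thesis .
  qed
  have box: "emeasure (P (\<lambda>\<omega>. h (Z i \<omega>, X i \<omega>))) (Pi\<^sub>E {1..n} A) =
      (\<Prod>j\<in>{1..n}. \<integral>\<^sup>+z. (if j = i then h z else 1) * indicator (A j) (snd z) \<partial>mix_law F \<theta>s)"
    if A: "\<And>j. j \<in> {1..n} \<Longrightarrow> A j \<in> sets borel"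
      and h [measurable]: "h \<in> borel_measurable (count_space UNIV \<Otimes>\<^sub>M borel)"
    for h :: "'q \<times> (real ^ 'd) \<Rightarrow> ennreal" and A
  proof -
    \<comment> \<open>The weight \<open>h\<close> concerns coordinate \<open>i\<close> only, so it
      is merged into that factor; the integral over a box then becomes a product over independent
      coordinates.\<close>
    define g where "g j z = (if j = i then h z else 1) * indicator (A j) (snd z)" for j z
    have g [measurable]: "g j \<in> borel_measurable (count_space UNIV \<Otimes>\<^sub>M borel)" if "j \<in> {1..n}" for j
      using A[OF that] unfolding g_def by measurable
    have "indep_vars (\<lambda>_. borel) (\<lambda>j \<omega>. g j (Z j \<omega>, X j \<omega>)) {1..n}"
      using indep_vars_compose2[OF indep_vars_subset[OF indep, of "{1..n}"] g] by auto
    then have "(\<integral>\<^sup>+\<omega>. (\<Prod>j\<in>{1..n}. g j (Z j \<omega>, X j \<omega>)) \<partial>M) =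
        (\<Prod>j\<in>{1..n}. \<integral>\<^sup>+\<omega>. g j (Z j \<omega>, X j \<omega>) \<partial>M)"
      by (intro indep_vars_nn_integral) auto
    also have "\<dots> = (\<Prod>j\<in>{1..n}. \<integral>\<^sup>+z. g j z \<partial>mix_law F \<theta>s)"
    proof (intro prod.cong refl)
      fix j assume j: "j \<in> {1..n}"
      then have "1 \<le> j" by simp
      then show "(\<integral>\<^sup>+\<omega>. g j (Z j \<omega>, X j \<omega>) \<partial>M) = (\<integral>\<^sup>+z. g j z \<partial>mix_law F \<theta>s)"
        using nn_integral_distr[OF ZX_measurable, of j "g j"] g[OF j] law
        by (simp add: measurable_cong_sets[OF sets_mix_law refl])
    qed
    finally have *: "(\<integral>\<^sup>+\<omega>. (\<Prod>j\<in>{1..n}. g j (Z j \<omega>, X j \<omega>)) \<partial>M) =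
        (\<Prod>j\<in>{1..n}. \<integral>\<^sup>+z. g j z \<partial>mix_law F \<theta>s)" .
    have "(\<Prod>j\<in>{1..n}. g j (Z j \<omega>, X j \<omega>)) =
        h (Z i \<omega>, X i \<omega>) * indicator (Pi\<^sub>E {1..n} A) (data X n \<omega>)" for \<omega>
    proof -
      have "(\<Prod>j\<in>{1..n}. g j (Z j \<omega>, X j \<omega>)) =
          (\<Prod>j\<in>{1..n}. if j = i then h (Z j \<omega>, X j \<omega>) else 1) * (\<Prod>j\<in>{1..n}. indicator (A j) (X j \<omega>))"
        unfolding prod.distrib[symmetric] g_def by (intro prod.cong) auto
      also have "(\<Prod>j\<in>{1..n}. if j = i then h (Z j \<omega>, X j \<omega>) else 1) = h (Z i \<omega>, X i \<omega>)"
        using i by (simp add: prod.delta)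
      also have "(\<Prod>j\<in>{1..n}. indicator (A j) (X j \<omega>)) =
          (indicator (Pi\<^sub>E {1..n} A) (data X n \<omega>) :: ennreal)"
        by (auto simp: indicator_def data_def PiE_def Pi_def split: if_splits)
      finally show ?thesis .
    qed
    moreover have "Pi\<^sub>E {1..n} A \<in> sets (data_space n)" using A by auto
    moreover have "(\<lambda>\<omega>. h (Z i \<omega>, X i \<omega>)) \<in> borel_measurable M" by measurable
    ultimately show ?thesis using * by (simp add: emP g_def)
  qed
  define a b where "a \<omega> = (indicator {q} (Z i \<omega>) :: ennreal)"
    and "b \<omega> = ennreal (post f q (X i \<omega>) \<theta>s)" for \<omega>
  have ab [measurable]: "a \<in> borel_measurable M" "b \<in> borel_measurable M"
    unfolding a_def b_def by measurable
  have "P a = P b"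
  proof (rule measure_eqI_PiM_finite[where I = "{1..n}" and M = "\<lambda>_. borel"])
    fix A :: "nat \<Rightarrow> (real ^ 'd) set" assume A: "\<And>j. j \<in> {1..n} \<Longrightarrow> A j \<in> sets borel"
    have "emeasure (P a) (Pi\<^sub>E {1..n} A) =
        (\<Prod>j\<in>{1..n}. \<integral>\<^sup>+z. (if j = i then indicator {q} (fst z) else 1) * indicator (A j) (snd z) \<partial>mix_law F \<theta>s)"
      using box[of A "\<lambda>z. indicator {q} (fst z)"] A by (simp add: a_def[abs_def])
    also have "\<dots> = (\<Prod>j\<in>{1..n}. \<integral>\<^sup>+z. (if j = i then ennreal (post f q (snd z) \<theta>s) else 1) *
        indicator (A j) (snd z) \<partial>mix_law F \<theta>s)"
    \<comment> \<open>The two products differ in the factor \<open>j = i\<close> only, where Bayes'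
      formula applies.\<close>
    proof (intro prod.cong refl)
      fix j assume "j \<in> {1..n}"
      then have "A j \<in> sets borel" by (rule A)
      then show "(\<integral>\<^sup>+z. (if j = i then indicator {q} (fst z) else 1) * indicator (A j) (snd z) \<partial>mix_law F \<theta>s) =
          (\<integral>\<^sup>+z. (if j = i then ennreal (post f q (snd z) \<theta>s) else 1) * indicator (A j) (snd z) \<partial>mix_law F \<theta>s)"
        using nn_integral_label[of "A j" q] by (cases "j = i") simp_all
    qed
    also have "\<dots> = emeasure (P b) (Pi\<^sub>E {1..n} A)"
      using box[of A "\<lambda>z. ennreal (post f q (snd z) \<theta>s)"] A by (simp add: b_def[abs_def])
    finally show "emeasure (P a) (Pi\<^sub>E {1..n} A) = emeasure (P b) (Pi\<^sub>E {1..n} A)" .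
  next
    show "range (\<lambda>_::nat. Pi\<^sub>E {1..n} (\<lambda>_. UNIV)) \<subseteq> prod_algebra {1..n} (\<lambda>_. borel)"
      by (auto intro: prod_algebraI_finite)
    have "emeasure (P a) (Pi\<^sub>E {1..n} (\<lambda>_. UNIV)) =
        (\<integral>\<^sup>+\<omega>. a \<omega> * indicator (Pi\<^sub>E {1..n} (\<lambda>_. UNIV)) (data X n \<omega>) \<partial>M)"
      by (rule emP) auto
    also have "\<dots> \<le> (\<integral>\<^sup>+\<omega>. 1 \<partial>M)"
      by (rule nn_integral_mono) (auto simp: a_def indicator_def)
    finally show "emeasure (P a) (Pi\<^sub>E {1..n} (\<lambda>_. UNIV)) \<noteq> \<infinity>"
      by (auto simp: emeasure_space_1 top_unique)
  qed (auto simp: P_def space_PiM)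
  then show ?thesis using emP[OF ab(1) B] emP[OF ab(2) B] by (simp add: a_def b_def)
qed

text \<open>By independence, conditioning on the whole sample leaves a function of
  \<open>X i\<close> alone. The posterior probability is recognised by its integrals over preimages
  of data events; the event \<open>Z i \<noteq> q\<close> follows by taking the complement.\<close>

lemma cond_exp_label:
  assumes i: "i \<in> {1..n}"
  shows "AE \<omega> in M. cond_exp_data M X n (\<lambda>\<omega>. of_bool (Z i \<omega> \<noteq> q)) \<omega> = 1 - post f q (X i \<omega>) \<theta>s"
proof -
  interpret G: finite_measure_subalgebra M "data_algebra n" by (rule data_algebra)
  have i1: "1 \<le> i" using i by simp
  note [measurable] = X_measurable[OF i1] Z_measurable[OF i1] post_measurable[OF valid]
  have int: "integrable M (\<lambda>\<omega>. of_bool (Z i \<omega> = q) :: real)"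
    by (intro integrable_const_bound[where B = 1]) auto
  have intp: "integrable M (\<lambda>\<omega>. post f q (X i \<omega>) \<theta>s)"
    by (intro integrable_const_bound[where B = 1]) (auto simp: post_bounds[OF f_nonneg valid])
  have "AE \<omega> in M. real_cond_exp M (data_algebra n) (\<lambda>\<omega>. of_bool (Z i \<omega> = q)) \<omega> = post f q (X i \<omega>) \<theta>s"
  proof (rule G.real_cond_exp_charact)
    show "(\<lambda>\<omega>. post f q (X i \<omega>) \<theta>s) \<in> borel_measurable (data_algebra n)"
      using measurable_compose[OF X_measurable_algebra[OF i] post_measurable[OF valid]] .
    fix A assume "A \<in> sets (data_algebra n)"
    moreover have "data X n \<in> space M \<rightarrow> space (data_space n)" using data_in_space by auto
    ultimately obtain B where B [measurable]: "B \<in> sets (data_space n)" and A: "A = data X n -` B \<inter> space M"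
      unfolding sets_vimage_algebra2[OF \<open>data X n \<in> space M \<rightarrow> space (data_space n)\<close>] by auto
    have "(\<integral>\<omega>\<in>A. (of_bool (Z i \<omega> = q) :: real) \<partial>M) = (\<integral>\<omega>. indicator {q} (Z i \<omega>) * indicator B (data X n \<omega>) \<partial>M)"
      unfolding set_lebesgue_integral_def by (intro Bochner_Integration.integral_cong) (auto simp: A indicator_def)
    also have "\<dots> = enn2real (\<integral>\<^sup>+\<omega>. indicator {q} (Z i \<omega>) * indicator B (data X n \<omega>) \<partial>M)"
      by (subst integral_eq_nn_integral) (auto simp: ennreal_mult simp flip: ennreal_indicator)
    also have "\<dots> = enn2real (\<integral>\<^sup>+\<omega>. ennreal (post f q (X i \<omega>) \<theta>s) * indicator B (data X n \<omega>) \<partial>M)"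
      by (simp add: label_integral_data[OF i B])
    also have "\<dots> = (\<integral>\<omega>. post f q (X i \<omega>) \<theta>s * indicator B (data X n \<omega>) \<partial>M)"
      by (subst integral_eq_nn_integral)
        (auto simp: ennreal_mult post_bounds[OF f_nonneg valid] simp flip: ennreal_indicator)
    also have "\<dots> = (\<integral>\<omega>\<in>A. post f q (X i \<omega>) \<theta>s \<partial>M)"
      unfolding set_lebesgue_integral_def by (intro Bochner_Integration.integral_cong) (auto simp: A indicator_def)
    finally show "(\<integral>\<omega>\<in>A. (of_bool (Z i \<omega> = q) :: real) \<partial>M) = (\<integral>\<omega>\<in>A. post f q (X i \<omega>) \<theta>s \<partial>M)" .
  qed (rule int intp)+
  moreover have "AE \<omega> in M. real_cond_exp M (data_algebra n) (\<lambda>\<omega>. 1 - of_bool (Z i \<omega> = q)) \<omega> =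
      real_cond_exp M (data_algebra n) (\<lambda>\<omega>. 1) \<omega> - real_cond_exp M (data_algebra n) (\<lambda>\<omega>. of_bool (Z i \<omega> = q)) \<omega>"
    using int by (intro G.real_cond_exp_diff) auto
  moreover have "AE \<omega> in M. real_cond_exp M (data_algebra n) (\<lambda>\<omega>. 1) \<omega> = 1"
    by (intro G.real_cond_exp_F_meas) auto
  ultimately have "AE \<omega> in M. real_cond_exp M (data_algebra n) (\<lambda>\<omega>. 1 - of_bool (Z i \<omega> = q)) \<omega> =
      1 - post f q (X i \<omega>) \<theta>s"
    by eventually_elim simp
  moreover have "(\<lambda>\<omega>. of_bool (Z i \<omega> \<noteq> q) :: real) = (\<lambda>\<omega>. 1 - of_bool (Z i \<omega> = q))" by auto
  ultimately show ?thesis unfolding cond_exp_data_def by simp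
qed

text \<open>The summation set and the assigned labels are random, but both are functions of the
  data. Spreading the sum over all pairs of an index and a label leaves data-measurable
  coefficients, which factor out, times indicators of fixed label events. The factor
  \<open>w\<close> makes room for the random denominator of the FMR.\<close>

lemma cond_exp_clust_err:
  fixes C :: "('q, 'd) proc"
  assumes C: "procedure n C" and w: "w \<in> borel_measurable (data_space n)"
    and wb: "\<forall>x\<in>space (data_space n). \<bar>w x\<bar> \<le> K"
  shows "AE \<omega> in M. cond_exp_data M X n (\<lambda>\<omega>. w (data X n \<omega>) *
      clust_err (snd C (data X n \<omega>)) (\<lambda>i. \<sigma> (fst C (data X n \<omega>) i)) (\<lambda>i. Z i \<omega>)) \<omega> =
    w (data X n \<omega>) * (\<Sum>i\<in>snd C (data X n \<omega>). 1 - post f (\<sigma> (fst C (data X n \<omega>) i)) (X i \<omega>) \<theta>s)"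
proof -
  interpret G: finite_measure_subalgebra M "data_algebra n" by (rule data_algebra)
  define I where "I = {1..n} \<times> (UNIV :: 'q set)"
  \<comment> \<open>The guards in \<open>a\<close> and \<open>e\<close> make the products integrable
    for every pair \<open>p\<close>, since the rule for conditional expectations of sums asks for
    this also outside \<open>I\<close>.\<close>
  define a where "a p x = (if p \<in> I then of_bool (fst p \<in> snd C x) * of_bool (\<sigma> (fst C x (fst p)) = snd p) * w x else 0)"
    for p x
  define c where "c p \<omega> = a p (data X n \<omega>)" for p \<omega>
  define e where "e p \<omega> = (of_bool (fst p \<in> {1..n} \<and> Z (fst p) \<omega> \<noteq> snd p) :: real)" for p \<omega>
  have S [measurable]: "snd C \<in> data_space n \<rightarrow>\<^sub>M count_space (Pow {1..n})" using C by (simp add: procedure_def)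
  have sub: "snd C x \<subseteq> {1..n}" if "x \<in> space (data_space n)" for x
    using measurable_space[OF S that] by simp
  note [measurable] = w
  have a_meas: "a p \<in> borel_measurable (data_space n)" for p
  proof (cases "p \<in> I")
    case True
    then have [measurable]: "(\<lambda>x. fst C x (fst p)) \<in> data_space n \<rightarrow>\<^sub>M count_space UNIV"
      using C by (auto simp: procedure_def I_def)
    have "(\<lambda>x. of_bool (fst p \<in> snd C x) :: real) \<in> borel_measurable (data_space n)"
      using measurable_compose[OF S, of "\<lambda>s. of_bool (fst p \<in> s) :: real" borel] by simp
    moreover have "(\<lambda>x. of_bool (\<sigma> (fst C x (fst p)) = snd p) :: real) \<in> borel_measurable (data_space n)"
      by measurable
    moreover have "a p = (\<lambda>x. of_bool (fst p \<in> snd C x) * of_bool (\<sigma> (fst C x (fst p)) = snd p) * w x)"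
      using True by (simp add: a_def fun_eq_iff)
    ultimately show ?thesis using w by (auto intro!: borel_measurable_times)
  qed (simp add: a_def[abs_def])
  have c_meas: "c p \<in> borel_measurable (data_algebra n)" for p
    unfolding c_def using measurable_compose[OF data_measurable_algebra a_meas] .
  have c_meas' [measurable]: "c p \<in> borel_measurable M" for p
    unfolding c_def using measurable_compose[OF data_measurable a_meas] .
  have e_meas [measurable]: "e p \<in> borel_measurable M" for p
  proof (cases "fst p \<in> {1..n}")
    case True
    then have [measurable]: "Z (fst p) \<in> M \<rightarrow>\<^sub>M count_space UNIV" by (intro Z_measurable) auto
    show ?thesis unfolding e_def by measurable
  next
    case False then show ?thesis unfolding e_def by (simp del: atLeastAtMost_iff)
  qed
  have int: "integrable M (\<lambda>\<omega>. c p \<omega> * e p \<omega>)" for p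
  proof (rule integrable_const_bound[where B = "\<bar>K\<bar>"])
    show "AE \<omega> in M. norm (c p \<omega> * e p \<omega>) \<le> \<bar>K\<bar>"
    proof (rule AE_I2)
      fix \<omega> assume "\<omega> \<in> space M"
      then have "\<bar>w (data X n \<omega>)\<bar> \<le> K" using wb data_in_space by blast
      then show "norm (c p \<omega> * e p \<omega>) \<le> \<bar>K\<bar>" by (auto simp: c_def a_def e_def)
    qed
  qed measurable
  have *: "(\<Sum>p\<in>I. c p \<omega> * g p) = w (data X n \<omega>) * (\<Sum>i\<in>snd C (data X n \<omega>). g (i, \<sigma> (fst C (data X n \<omega>) i)))"
    if \<omega>: "\<omega> \<in> space M" for \<omega> and g :: "nat \<times> 'q \<Rightarrow> real"
  proof -
    let ?x = "data X n \<omega>"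
    have "(\<Sum>p\<in>I. c p \<omega> * g p) = (\<Sum>i\<in>{1..n}. \<Sum>q\<in>UNIV. c (i, q) \<omega> * g (i, q))"
      unfolding I_def by (simp add: sum.cartesian_product)
    also have "\<dots> = (\<Sum>i\<in>{1..n}. \<Sum>q\<in>UNIV. if q = \<sigma> (fst C ?x i) then
        of_bool (i \<in> snd C ?x) * w ?x * g (i, \<sigma> (fst C ?x i)) else 0)"
      by (intro sum.cong refl) (auto simp: c_def a_def I_def)
    also have "\<dots> = (\<Sum>i\<in>{1..n}. if i \<in> snd C ?x then w ?x * g (i, \<sigma> (fst C ?x i)) else 0)"
      by (intro sum.cong refl) simp
    also have "\<dots> = (\<Sum>i\<in>snd C ?x. w ?x * g (i, \<sigma> (fst C ?x i)))"
      using sub[OF data_in_space[OF \<omega>]] by (intro sum.mono_neutral_cong_right) (auto split: if_splits)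
    finally show ?thesis by (simp add: sum_distrib_left)
  qed
  have err: "w (data X n \<omega>) * clust_err (snd C (data X n \<omega>)) (\<lambda>i. \<sigma> (fst C (data X n \<omega>) i)) (\<lambda>i. Z i \<omega>) =
      (\<Sum>p\<in>I. c p \<omega> * e p \<omega>)" if \<omega>: "\<omega> \<in> space M" for \<omega>
    unfolding *[OF \<omega>] clust_err_def using sub[OF data_in_space[OF \<omega>]]
    by (intro arg_cong2[where f = "(*)"] refl sum.cong) (auto simp: e_def)
  have "AE \<omega> in M. real_cond_exp M (data_algebra n) (\<lambda>\<omega>. w (data X n \<omega>) *
      clust_err (snd C (data X n \<omega>)) (\<lambda>i. \<sigma> (fst C (data X n \<omega>) i)) (\<lambda>i. Z i \<omega>)) \<omega> =
      real_cond_exp M (data_algebra n) (\<lambda>\<omega>. \<Sum>p\<in>I. c p \<omega> * e p \<omega>) \<omega>"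
  proof (rule G.real_cond_exp_cong)
    show "AE \<omega> in M. w (data X n \<omega>) * clust_err (snd C (data X n \<omega>))
        (\<lambda>i. \<sigma> (fst C (data X n \<omega>) i)) (\<lambda>i. Z i \<omega>) = (\<Sum>p\<in>I. c p \<omega> * e p \<omega>)"
      using err by (intro AE_I2) auto
    show "(\<lambda>\<omega>. \<Sum>p\<in>I. c p \<omega> * e p \<omega>) \<in> borel_measurable M" by measurable
    then show "(\<lambda>\<omega>. w (data X n \<omega>) * clust_err (snd C (data X n \<omega>))
        (\<lambda>i. \<sigma> (fst C (data X n \<omega>) i)) (\<lambda>i. Z i \<omega>)) \<in> borel_measurable M"
      by (subst measurable_cong[OF err])
  qed
  moreover have "AE \<omega> in M. real_cond_exp M (data_algebra n) (\<lambda>\<omega>. \<Sum>p\<in>I. c p \<omega> * e p \<omega>) \<omega> =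
      (\<Sum>p\<in>I. real_cond_exp M (data_algebra n) (\<lambda>\<omega>. c p \<omega> * e p \<omega>) \<omega>)"
    by (rule G.real_cond_exp_sum[OF int])
  moreover have "AE \<omega> in M. \<forall>p\<in>I. real_cond_exp M (data_algebra n) (\<lambda>\<omega>. c p \<omega> * e p \<omega>) \<omega> =
      c p \<omega> * (1 - post f (snd p) (X (fst p) \<omega>) \<theta>s)"
  proof (rule AE_finite_allI)
    show "finite I" by (simp add: I_def)
    fix p assume p: "p \<in> I"
    have "AE \<omega> in M. real_cond_exp M (data_algebra n) (\<lambda>\<omega>. c p \<omega> * e p \<omega>) \<omega> =
        c p \<omega> * real_cond_exp M (data_algebra n) (e p) \<omega>"
      by (rule G.real_cond_exp_mult[OF c_meas e_meas int])
    moreover have "AE \<omega> in M. real_cond_exp M (data_algebra n) (e p) \<omega> = 1 - post f (snd p) (X (fst p) \<omega>) \<theta>s"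
    proof -
      have ip: "fst p \<in> {1..n}" using p by (auto simp: I_def)
      then have "e p = (\<lambda>\<omega>. of_bool (Z (fst p) \<omega> \<noteq> snd p))" by (auto simp: e_def)
      then show ?thesis using cond_exp_label[OF ip, of "snd p"] by (simp add: cond_exp_data_def)
    qed
    ultimately show "AE \<omega> in M. real_cond_exp M (data_algebra n) (\<lambda>\<omega>. c p \<omega> * e p \<omega>) \<omega> =
      c p \<omega> * (1 - post f (snd p) (X (fst p) \<omega>) \<theta>s)" by eventually_elim simp
  qed
  ultimately show ?thesis
    unfolding cond_exp_data_def using AE_space
  proof eventually_elim
    case (elim \<omega>)
    then have "real_cond_exp M (data_algebra n) (\<lambda>\<omega>. w (data X n \<omega>) *
        clust_err (snd C (data X n \<omega>)) (\<lambda>i. \<sigma> (fst C (data X n \<omega>) i)) (\<lambda>i. Z i \<omega>)) \<omega> =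
        (\<Sum>p\<in>I. c p \<omega> * (1 - post f (snd p) (X (fst p) \<omega>) \<theta>s))"
      by simp
    also have "\<dots> = w (data X n \<omega>) *
        (\<Sum>i\<in>snd C (data X n \<omega>). 1 - post f (\<sigma> (fst C (data X n \<omega>) i)) (X i \<omega>) \<theta>s)"
      using *[OF elim(4), of "\<lambda>p. 1 - post f (snd p) (X (fst p) \<omega>) \<theta>s"] by simp
    finally show ?case .
  qed
qed

section \<open>Moments and concentration of sums over the sample\<close>

lemma integrable_PX:
  fixes h :: "real ^ 'd \<Rightarrow> real"
  assumes "h \<in> borel_measurable borel" "\<And>x. \<bar>h x\<bar> \<le> K"
  shows "integrable PX h"
proof -
  interpret PX: prob_space PX by (rule prob_space_PX)
  show ?thesis using assms
    by (intro PX.integrable_const_bound[where B = K]) (auto simp: measurable_cong_sets[OF sets_PX refl])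
qed

lemma integrable_X:
  fixes h :: "real ^ 'd \<Rightarrow> real"
  assumes "h \<in> borel_measurable borel" "\<And>x. \<bar>h x\<bar> \<le> K" "1 \<le> i"
  shows "integrable M (\<lambda>\<omega>. h (X i \<omega>))"
  using assms measurable_compose[OF X_measurable[OF assms(3)] assms(1)]
  by (intro integrable_const_bound[where B = K]) auto

lemma integrable_sum_X:
  fixes h :: "real ^ 'd \<Rightarrow> real"
  assumes "h \<in> borel_measurable borel" "\<And>x. \<bar>h x\<bar> \<le> K"
  shows "integrable M (\<lambda>\<omega>. \<Sum>i=1..n. h (X i \<omega>))"
  using integrable_X[OF assms] by (intro Bochner_Integration.integrable_sum) auto

lemma expectation_sum_X:
  fixes h :: "real ^ 'd \<Rightarrow> real"
  assumes "h \<in> borel_measurable borel" "\<And>x. \<bar>h x\<bar> \<le> K"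
  shows "expectation (\<lambda>\<omega>. \<Sum>i=1..n. h (X i \<omega>)) = real n * (\<integral>x. h x \<partial>PX)"
proof -
  have "expectation (\<lambda>\<omega>. \<Sum>i=1..n. h (X i \<omega>)) = (\<Sum>i=1..n. expectation (\<lambda>\<omega>. h (X i \<omega>)))"
    using integrable_X[OF assms] by (intro Bochner_Integration.integral_sum) auto
  also have "\<dots> = (\<Sum>i=1..n. \<integral>x. h x \<partial>PX)"
    using expectation_X[OF _ assms(1)] by (intro sum.cong) auto
  finally show ?thesis by simp
qed

text \<open>Hoeffding's inequality: the sum has mean \<open>n * \<mu>\<close> with
  \<open>\<mu> < 0\<close>, so a positive sum is a deviation proportional to \<open>n\<close>, whose
  probability decays geometrically.\<close>

lemma prob_sum_pos_tendsto_0: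
  fixes h :: "real ^ 'd \<Rightarrow> real"
  assumes h: "h \<in> borel_measurable borel" and bound: "\<And>x. \<bar>h x\<bar> \<le> K" and neg: "(\<integral>x. h x \<partial>PX) < 0"
  shows "(\<lambda>n. prob {\<omega> \<in> space M. 0 < (\<Sum>i=1..n. h (X i \<omega>))}) \<longlonglongrightarrow> 0"
proof -
  define \<mu> where "\<mu> = (\<integral>x. h x \<partial>PX)"
  \<comment> \<open>Adding \<open>1\<close> makes the width of the range positive even for
    \<open>K = 0\<close>.\<close>
  define L where "L = K + 1"
  have L: "0 < L" "\<bar>h x\<bar> \<le> L" for x
    using bound[of x] abs_ge_zero[of "h x"] by (simp_all add: L_def)
  \<comment> \<open>Hoeffding's exponent per observation: \<open>2 (n \<mu>)^2 / (n (2 L)^2)\<close>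
    equals \<open>n c\<close>.\<close>
  define c where "c = \<mu>\<^sup>2 / (2 * L\<^sup>2)"
  have c: "0 < c" using neg L by (simp add: c_def \<mu>_def)
  have le: "prob {\<omega> \<in> space M. 0 < (\<Sum>i=1..n. h (X i \<omega>))} \<le> exp (- c) ^ n" if n: "1 \<le> n" for n
  proof -
    have ind: "indep_vars (\<lambda>_. borel) (\<lambda>i \<omega>. h (snd (Z i \<omega>, X i \<omega>))) {1..n}"
      using indep_vars_compose2[OF indep_vars_subset[OF indep, of "{1..n}"],
          of "\<lambda>_ z. h (snd z)" "\<lambda>_. borel"] h by auto
    interpret H: Hoeffding_ineq M "{1..n}" "\<lambda>i \<omega>. h (X i \<omega>)" "\<lambda>_. - L" "\<lambda>_. L" "real n * \<mu>"
    proof unfold_locales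
      show "indep_vars (\<lambda>_. borel) (\<lambda>i \<omega>. h (X i \<omega>)) {1..n}" using ind by simp
      show "AE \<omega> in M. h (X i \<omega>) \<in> {- L..L}" for i
        using L(2) by (intro AE_I2) (simp add: abs_le_iff minus_le_iff)
      show "real n * \<mu> \<equiv> (\<Sum>i=1..n. expectation (\<lambda>\<omega>. h (X i \<omega>)))"
        using expectation_X[OF _ h] by (intro eq_reflection) (simp add: \<mu>_def)
    qed simp
    have [measurable]: "X i \<in> borel_measurable M" if "i \<in> {1..n}" for i
      using that by (intro X_measurable) auto
    note [measurable] = h
    have "prob {\<omega> \<in> space M. 0 < (\<Sum>i=1..n. h (X i \<omega>))} \<le>
        prob {\<omega> \<in> space M. (\<Sum>i=1..n. h (X i \<omega>)) \<ge> real n * \<mu> + - (real n * \<mu>)}"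
      by (intro finite_measure_mono) auto
    also have "\<dots> \<le> exp (- 2 * (- (real n * \<mu>))\<^sup>2 / (\<Sum>i=1..n. (L - (- L))\<^sup>2))"
      using neg n L by (intro H.Hoeffding_ineq_ge) (auto simp: \<mu>_def mult_le_0_iff)
    also have "- 2 * (- (real n * \<mu>))\<^sup>2 / (\<Sum>i=1..n. (L - (- L))\<^sup>2) = real n * (- c)"
      using n L by (simp add: c_def power2_eq_square field_simps)
    also have "exp (real n * (- c)) = exp (- c) ^ n" by (rule exp_of_nat_mult)
    finally show ?thesis .
  qed
  show ?thesis
  proof (rule tendsto_sandwich[OF _ _ tendsto_const])
    show "(\<lambda>n. exp (- c) ^ n) \<longlonglongrightarrow> 0" using c by (intro LIMSEQ_realpow_zero) auto
    show "eventually (\<lambda>n. prob {\<omega> \<in> space M. 0 < (\<Sum>i=1..n. h (X i \<omega>))} \<le> exp (- c) ^ n) sequentially"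
      using eventually_ge_at_top[of 1] by eventually_elim (rule le)
  qed simp
qed

section \<open>Selection size, loss and conditional risk of an arbitrary procedure\<close>

lemma selected_measurable:
  fixes C :: "('q, 'd) proc"
  assumes "procedure n C"
  shows "(\<lambda>\<omega>. g (snd C (data X n \<omega>)) :: real) \<in> borel_measurable M"
proof -
  have "snd C \<in> data_space n \<rightarrow>\<^sub>M count_space (Pow {1..n})" using assms by (simp add: procedure_def)
  from measurable_compose[OF measurable_compose[OF data_measurable this], of g borel] show ?thesis by simp
qed

lemma selected_subset:
  fixes C :: "('q, 'd) proc"
  assumes "procedure n C" "\<omega> \<in> space M"
  shows "snd C (data X n \<omega>) \<subseteq> {1..n}"
proof -
  have "snd C \<in> data_space n \<rightarrow>\<^sub>M count_space (Pow {1..n})" using assms by (simp add: procedure_def)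
  from measurable_space[OF this data_in_space[OF assms(2)]] show ?thesis by simp
qed

lemma card_selected_le:
  fixes C :: "('q, 'd) proc"
  assumes "procedure n C" "\<omega> \<in> space M"
  shows "card (snd C (data X n \<omega>)) \<le> n"
  using card_mono[OF _ selected_subset[OF assms]] by simp

lemma integrable_card_selected:
  fixes C :: "('q, 'd) proc"
  assumes "procedure n C"
  shows "integrable M (\<lambda>\<omega>. real (card (snd C (data X n \<omega>))))"
  using card_selected_le[OF assms] selected_measurable[OF assms, of "\<lambda>S. real (card S)"]
  by (intro integrable_const_bound[where B = "real n"]) auto

text \<open>By \<open>cond_exp_clust_err\<close>, a version of the conditional expectation, given
  the data, of the error count after relabelling by \<sigma>.\<close>

definition loss :: "nat \<Rightarrow> ('q, 'd) proc \<Rightarrow> ('q \<Rightarrow> 'q) \<Rightarrow> 'w \<Rightarrow> real" where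
  "loss n C \<sigma> \<omega> = (\<Sum>i\<in>snd C (data X n \<omega>). 1 - post f (\<sigma> (fst C (data X n \<omega>) i)) (X i \<omega>) \<theta>s)"

text \<open>The first lower bound is free of \<sigma> and of the assigned labels, so it survives the
  minimum over permutations.\<close>

lemma loss_bounds:
  "(\<Sum>i\<in>snd C (data X n \<omega>). Tstat f (X i \<omega>) \<theta>s) \<le> loss n C \<sigma> \<omega>"
  "0 \<le> loss n C \<sigma> \<omega>" "loss n C \<sigma> \<omega> \<le> real (card (snd C (data X n \<omega>)))"
proof -
  show "(\<Sum>i\<in>snd C (data X n \<omega>). Tstat f (X i \<omega>) \<theta>s) \<le> loss n C \<sigma> \<omega>"
    unfolding loss_def by (intro sum_mono Tstat_le)
  show "0 \<le> loss n C \<sigma> \<omega>"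
    unfolding loss_def using post_bounds(2)[OF f_nonneg valid] by (intro sum_nonneg) simp
  show "loss n C \<sigma> \<omega> \<le> real (card (snd C (data X n \<omega>)))"
    unfolding loss_def using post_bounds(1)[OF f_nonneg valid]
    by (simp add: sum_bounded_above[where K = "1 :: real", simplified])
qed

text \<open>The weight \<open>w\<close> treats both rates at once: the constant \<open>1\<close>
  yields the numerator of the mFMR, the inverse of the selection size yields the FMR.\<close>

definition cond_risk :: "nat \<Rightarrow> ('q, 'd) proc \<Rightarrow> ((nat \<Rightarrow> real ^ 'd) \<Rightarrow> real) \<Rightarrow> 'w \<Rightarrow> real" where
  "cond_risk n C w \<omega> = (MIN \<sigma>\<in>{\<sigma>. \<sigma> permutes UNIV}. cond_exp_data M X n (\<lambda>\<omega>. w (data X n \<omega>) *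
      clust_err (snd C (data X n \<omega>)) (\<lambda>i. \<sigma> (fst C (data X n \<omega>) i)) (\<lambda>i. Z i \<omega>)) \<omega>)"

lemma finite_perms: "finite {\<sigma> :: 'q \<Rightarrow> 'q. \<sigma> permutes UNIV}"
  by (rule finite_permutations) simp

text \<open>There are finitely many permutations, so their exceptional null sets combine into one
  and the minimum can be taken pointwise.\<close>

lemma AE_cond_risk:
  assumes "procedure n C" "w \<in> borel_measurable (data_space n)"
    "\<forall>x\<in>space (data_space n). \<bar>w x\<bar> \<le> K"
  shows "AE \<omega> in M. cond_risk n C w \<omega> = (MIN \<sigma>\<in>{\<sigma>. \<sigma> permutes UNIV}. w (data X n \<omega>) * loss n C \<sigma> \<omega>)"
proof -
  have "AE \<omega> in M. \<forall>\<sigma>\<in>{\<sigma>. \<sigma> permutes UNIV}. cond_exp_data M X n (\<lambda>\<omega>. w (data X n \<omega>) *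
      clust_err (snd C (data X n \<omega>)) (\<lambda>i. \<sigma> (fst C (data X n \<omega>) i)) (\<lambda>i. Z i \<omega>)) \<omega> =
      w (data X n \<omega>) * loss n C \<sigma> \<omega>"
    unfolding loss_def using finite_perms by (rule AE_finite_allI) (rule cond_exp_clust_err[OF assms])
  then show ?thesis unfolding cond_risk_def by eventually_elim (intro arg_cong[where f = Min] image_cong, auto)
qed

lemma integrable_cond_risk:
  assumes "procedure n C" "w \<in> borel_measurable (data_space n)"
    "\<forall>x\<in>space (data_space n). \<bar>w x\<bar> \<le> K"
  shows "integrable M (cond_risk n C w)"
proof (rule integrable_const_bound[where B = "K * real n"])
  show "cond_risk n C w \<in> borel_measurable M"
    unfolding cond_risk_def[abs_def] cond_exp_data_def
    by (intro borel_measurable_Min finite_perms) simp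
  show "AE \<omega> in M. norm (cond_risk n C w \<omega>) \<le> K * real n"
    using AE_cond_risk[OF assms] AE_space
  proof eventually_elim
    case (elim \<omega>)
    have "(MIN \<sigma>\<in>{\<sigma>. \<sigma> permutes UNIV}. w (data X n \<omega>) * loss n C \<sigma> \<omega>) \<in>
        (\<lambda>\<sigma>. w (data X n \<omega>) * loss n C \<sigma> \<omega>) ` {\<sigma>. \<sigma> permutes UNIV}"
      using finite_perms by (intro Min_in) (auto intro: permutes_id)
    then obtain \<sigma> where "cond_risk n C w \<omega> = w (data X n \<omega>) * loss n C \<sigma> \<omega>"
      using elim by auto
    moreover have "\<bar>w (data X n \<omega>)\<bar> \<le> K" using assms(3) data_in_space[OF elim(2)] by blast
    moreover have "\<bar>loss n C \<sigma> \<omega>\<bar> \<le> real n"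
      using loss_bounds(2,3)[where n = n and C = C and \<omega> = \<omega> and \<sigma> = \<sigma>] card_selected_le[OF assms(1) elim(2)] by simp
    ultimately show ?case by (simp add: abs_mult mult_mono')
  qed
qed

lemma mFMR_eq: "mFMR M Z X n C = expectation (cond_risk n C (\<lambda>_. 1)) / exp_selected M X n C"
  unfolding mFMR_def cond_risk_def[abs_def] by simp

lemma FMR_eq: "FMR M Z X n C = expectation (cond_risk n C (\<lambda>x. 1 / real (max (card (snd C x)) 1)))"
  unfolding FMR_def cond_risk_def[abs_def] by simp

text \<open>The permutation is quantified inside the almost sure statement because later it is
  chosen separately for each \<omega>, from the value of the estimator.\<close>

lemma cond_risk_le:
  assumes "procedure n C" "w \<in> borel_measurable (data_space n)"
    "\<forall>x\<in>space (data_space n). \<bar>w x\<bar> \<le> K"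
  shows "AE \<omega> in M. \<forall>\<sigma>. \<sigma> permutes UNIV \<longrightarrow> cond_risk n C w \<omega> \<le> w (data X n \<omega>) * loss n C \<sigma> \<omega>"
  using AE_cond_risk[OF assms]
proof eventually_elim
  case (elim \<omega>)
  then show ?case using finite_perms by (auto intro: Min_le)
qed

text \<open>No choice of labels errs with conditional probability below \<open>Tstat\<close>, under
  any permutation. This is the only information about a competitor's labels that its comparison with
  the plug-in rule uses.\<close>

lemma expectation_selected_Tstat_le:
  fixes C :: "('q, 'd) proc"
  assumes C: "procedure n C"
  shows "integrable M (\<lambda>\<omega>. \<Sum>i\<in>snd C (data X n \<omega>). Tstat f (X i \<omega>) \<theta>s)"
    and "expectation (\<lambda>\<omega>. \<Sum>i\<in>snd C (data X n \<omega>). Tstat f (X i \<omega>) \<theta>s) \<le> expectation (cond_risk n C (\<lambda>_. 1))"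
proof -
  let ?g = "\<lambda>\<omega>. \<Sum>i\<in>snd C (data X n \<omega>). Tstat f (X i \<omega>) \<theta>s"
  \<comment> \<open>Measurability of a sum over a random set is obtained by writing it as a full sum
    with indicators.\<close>
  have "(\<lambda>\<omega>. of_bool (i \<in> snd C (data X n \<omega>)) * Tstat f (X i \<omega>) \<theta>s) \<in> borel_measurable M" if "i \<in> {1..n}" for i
    using that selected_measurable[OF C, of "\<lambda>S. of_bool (i \<in> S)"]
      measurable_compose[OF X_measurable Tstat_measurable[OF valid]] by (intro borel_measurable_times) auto
  then have "(\<lambda>\<omega>. \<Sum>i=1..n. of_bool (i \<in> snd C (data X n \<omega>)) * Tstat f (X i \<omega>) \<theta>s) \<in> borel_measurable M"
    by (rule borel_measurable_sum)
  moreover have "?g \<omega> = (\<Sum>i=1..n. of_bool (i \<in> snd C (data X n \<omega>)) * Tstat f (X i \<omega>) \<theta>s)" if "\<omega> \<in> space M" for \<omega>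
    using selected_subset[OF C that] by (intro sum.mono_neutral_cong_left) auto
  ultimately have meas: "?g \<in> borel_measurable M" by (subst measurable_cong) auto
  have "0 \<le> ?g \<omega> \<and> ?g \<omega> \<le> real n" if "\<omega> \<in> space M" for \<omega>
    using loss_bounds(1,3)[where n = n and C = C and \<omega> = \<omega> and \<sigma> = id] card_selected_le[OF C that]
    by (auto intro!: sum_nonneg Tstat_bounds[OF f_nonneg valid])
  then show int: "integrable M ?g" using meas by (intro integrable_const_bound[where B = "real n"]) auto
  have "AE \<omega> in M. ?g \<omega> \<le> cond_risk n C (\<lambda>_. 1) \<omega>"
    using AE_cond_risk[OF C, of "\<lambda>_. 1" 1, simplified]
  proof eventually_elim
    case (elim \<omega>)
    then show ?case using finite_perms loss_bounds(1)[where n = n and C = C and \<omega> = \<omega>] by (auto intro!: Min.boundedI permutes_id)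
  qed
  then show "expectation ?g \<le> expectation (cond_risk n C (\<lambda>_. 1))"
    using integral_mono_AE[OF int integrable_cond_risk[OF C, of "\<lambda>_. 1" 1, simplified]] by blast
qed

text \<open>A Lagrangian argument: \<open>(t - T\<^sub>i) 1{i \<in> S} \<le> (t - T\<^sub>i)\<^sup>+\<close> for every selection rule.\<close>

lemma exp_selected_le:
  assumes C: "procedure n C" and risk: "mFMR M Z X n C \<le> \<alpha>" and t: "\<alpha> < t"
    and G: "0 \<le> (\<integral>x. (Tstat f x \<theta>s - \<alpha>) * of_bool (Tstat f x \<theta>s < t) \<partial>PX)"
  shows "exp_selected M X n C \<le> real n * measure PX {x. Tstat f x \<theta>s < t}"
\<comment> \<open>If the expected size is \<open>0\<close>, the bound is immediate, whereas the
  quotient \<open>mFMR\<close> carries no information.\<close>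
proof (cases "exp_selected M X n C = 0")
  case False
  note [measurable] = Tstat_measurable[OF valid]
  define N where "N = exp_selected M X n C"
  have N: "0 < N" using False unfolding N_def exp_selected_def by (simp add: less_le)
  have Tb: "0 \<le> Tstat f x \<theta>s" "Tstat f x \<theta>s \<le> 1" for x
    using Tstat_bounds[OF f_nonneg valid] by auto
  define h where "h x = (t - Tstat f x \<theta>s) * of_bool (Tstat f x \<theta>s < t)" for x
  have h: "h \<in> borel_measurable borel" "\<bar>h x\<bar> \<le> \<bar>t\<bar> + 1" for x
    unfolding h_def[abs_def] using Tb[of x] by (auto simp: of_bool_def)
  let ?S = "\<lambda>\<omega>. snd C (data X n \<omega>)"
  let ?g = "\<lambda>\<omega>. \<Sum>i\<in>?S \<omega>. Tstat f (X i \<omega>) \<theta>s"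
  have "expectation ?g \<le> \<alpha> * N"
    using expectation_selected_Tstat_le(2)[OF C] risk N by (simp add: mFMR_eq N_def[symmetric] divide_le_eq)
  then have "(t - \<alpha>) * N \<le> t * N - expectation ?g" by (simp add: algebra_simps)
  also have "\<dots> = expectation (\<lambda>\<omega>. t * real (card (?S \<omega>)) - ?g \<omega>)"
    using expectation_selected_Tstat_le(1)[OF C] integrable_card_selected[OF C]
    by (simp add: N_def exp_selected_def)
  also have "\<dots> \<le> expectation (\<lambda>\<omega>. \<Sum>i=1..n. h (X i \<omega>))"
  proof (rule integral_mono)
    fix \<omega> assume \<omega>: "\<omega> \<in> space M"
    have "t * real (card (?S \<omega>)) - ?g \<omega> = (\<Sum>i\<in>?S \<omega>. t - Tstat f (X i \<omega>) \<theta>s)"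
      by (simp add: sum_subtractf)
    also have "\<dots> \<le> (\<Sum>i\<in>?S \<omega>. h (X i \<omega>))" by (intro sum_mono) (auto simp: h_def)
    also have "\<dots> \<le> (\<Sum>i=1..n. h (X i \<omega>))"
      using selected_subset[OF C \<omega>] by (intro sum_mono2) (auto simp: h_def)
    finally show "t * real (card (?S \<omega>)) - ?g \<omega> \<le> (\<Sum>i=1..n. h (X i \<omega>))" .
  qed (use expectation_selected_Tstat_le(1)[OF C] integrable_card_selected[OF C] integrable_sum_X[OF h] in auto)
  also have "\<dots> = real n * (\<integral>x. h x \<partial>PX)" by (rule expectation_sum_X[OF h])
  \<comment> \<open>Splits \<open>t - T\<close> into \<open>t - \<alpha>\<close> minus
    \<open>T - \<alpha>\<close>: the mean of the second part over \<open>T < t\<close> is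
    nonnegative by \<open>G\<close> and is dropped, and the positive factor
    \<open>t - \<alpha>\<close> cancels in the end.\<close>
  also have "(\<integral>x. h x \<partial>PX) =
      (\<integral>x. (t - \<alpha>) * indicator {x. Tstat f x \<theta>s < t} x - (Tstat f x \<theta>s - \<alpha>) * of_bool (Tstat f x \<theta>s < t) \<partial>PX)"
    by (intro Bochner_Integration.integral_cong) (auto simp: h_def indicator_def algebra_simps)
  also have "\<dots> = (t - \<alpha>) * measure PX {x. Tstat f x \<theta>s < t} -
      (\<integral>x. (Tstat f x \<theta>s - \<alpha>) * of_bool (Tstat f x \<theta>s < t) \<partial>PX)"
  proof (subst Bochner_Integration.integral_diff)
    show "integrable PX (\<lambda>x. (t - \<alpha>) * indicator {x. Tstat f x \<theta>s < t} x)"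
      by (rule integrable_PX[where K = "\<bar>t - \<alpha>\<bar>"]) (auto simp: indicator_def)
    show "integrable PX (\<lambda>x. (Tstat f x \<theta>s - \<alpha>) * of_bool (Tstat f x \<theta>s < t))"
    proof (rule integrable_PX[where K = "1 + \<bar>\<alpha>\<bar>"])
      show "\<bar>(Tstat f x \<theta>s - \<alpha>) * of_bool (Tstat f x \<theta>s < t)\<bar> \<le> 1 + \<bar>\<alpha>\<bar>" for x
        using Tb[of x] by (auto simp: of_bool_def)
    qed measurable
  qed simp
  finally have "(t - \<alpha>) * N \<le> (t - \<alpha>) * (real n * measure PX {x. Tstat f x \<theta>s < t})"
    using mult_nonneg_nonneg[OF of_nat_0_le_iff[of n] G] by (simp add: algebra_simps)
  then show ?thesis using t unfolding N_def by (simp add: mult_le_cancel_left_pos)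
qed simp

text \<open>Almost surely the posterior probabilities sum to \<open>1\<close>, so one of them is
  positive. Hence conditioning on \<open>T < 1\<close> is vacuous and \<open>alpha_bar\<close> is
  the plain mean of \<open>T\<close>.\<close>

lemma AE_Tstat_less_1: "AE x in PX. Tstat f x \<theta>s < 1"
  using AE_mix_density_pos
proof eventually_elim
  case (elim x)
  then have "(\<Sum>q\<in>UNIV. post f q x \<theta>s) = 1" by (intro sum_post_eq_1) simp
  then obtain q where "post f q x \<theta>s \<noteq> 0" by (metis sum.neutral zero_neq_one)
  then have "0 < post f q x \<theta>s" using post_bounds(1)[OF f_nonneg valid, of q x] by simp
  then show ?case using Tstat_le[of f x \<theta>s q] by simp
qed

end

section \<open>The oracle threshold\<close>

locale continuous_mixture = mixture_sample M U F f \<theta>s Z X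
  for M :: "'w measure" and U :: "'u::euclidean_space set" and F :: "'u \<Rightarrow> (real ^ 'd) measure"
    and f and \<theta>s :: "('q::finite, 'u) param" and Z and X +
  assumes no_atoms: "\<And>q c. measure (obs_law F \<theta>s) {x. post f q x \<theta>s = c} = 0"
begin

abbreviation "T x \<equiv> Tstat f x \<theta>s"

definition "Tcdf t = measure PX {x. T x < t}"

text \<open>The numerator of \<open>mFMR_star\<close> minus \<alpha>. It has the same sign as that
  difference wherever the event has positive probability, avoids the division, and is continuous in
  the threshold.\<close>

definition "excess \<alpha> t = (\<integral>x. (T x - \<alpha>) * of_bool (T x < t) \<partial>PX)"

lemma T_measurable [measurable]: "T \<in> borel_measurable borel"
  by (rule Tstat_measurable[OF valid])

lemma T_bounds: "0 \<le> T x" "T x \<le> 1"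
  using Tstat_bounds[OF f_nonneg valid] by auto

text \<open>\<open>T\<close> always equals \<open>1 - post\<close> for some label, so an atom of
  \<open>T\<close> would be an atom of one of finitely many posterior probabilities.\<close>

lemma AE_T_neq: "AE x in PX. T x \<noteq> t"
proof -
  interpret PX: prob_space PX by (rule prob_space_PX)
  note [measurable] = post_measurable[OF valid]
  have "AE x in PX. \<forall>q\<in>UNIV. post f q x \<theta>s \<noteq> 1 - t"
  proof (rule AE_finite_allI)
    fix q
    have "{x. post f q x \<theta>s = 1 - t} \<in> null_sets PX"
      using no_atoms by (intro null_setsI) (auto simp: PX.emeasure_eq_measure)
    then show "AE x in PX. post f q x \<theta>s \<noteq> 1 - t" by (rule AE_I') auto
  qed simp
  then show ?thesis
  proof eventually_elim
    case (elim x)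
    have "(MAX q\<in>UNIV. post f q x \<theta>s) \<in> range (\<lambda>q. post f q x \<theta>s)" by (intro Max_in) auto
    then obtain q where "(MAX q\<in>UNIV. post f q x \<theta>s) = post f q x \<theta>s" by blast
    then have "T x = 1 - post f q x \<theta>s" by (simp add: Tstat_def)
    moreover have "post f q x \<theta>s \<noteq> 1 - t" using elim by simp
    ultimately show ?case by linarith
  qed
qed

lemma AE_T: "AE x in PX. 0 < T x" "AE x in PX. T x < 1"
proof -
  show "AE x in PX. 0 < T x" using AE_T_neq[of 0] T_bounds(1) by (auto simp: less_le)
  show "AE x in PX. T x < 1" by (rule AE_Tstat_less_1)
qed

text \<open>As thresholds converge, the indicator at \<open>x\<close> is eventually constant unless
  \<open>T x\<close> equals the limit, which is a null event; dominated convergence does the rest.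
  Both the distribution function and the excess are of this form.\<close>

lemma continuous_truncated_integral:
  fixes h :: "real ^ 'd \<Rightarrow> real"
  assumes h: "h \<in> borel_measurable borel" "\<And>x. \<bar>h x\<bar> \<le> K"
  shows "continuous_on UNIV (\<lambda>t. \<integral>x. h x * of_bool (T x < t) \<partial>PX)"
  unfolding continuous_on_sequentially comp_def
proof (intro allI impI ballI, elim conjE)
  fix s :: "nat \<Rightarrow> real" and t assume s: "s \<longlonglongrightarrow> t"
  interpret PX: prob_space PX by (rule prob_space_PX)
  note [measurable] = h(1)
  have K: "0 \<le> K" using h(2)[of undefined] by (meson abs_ge_zero order_trans)
  show "(\<lambda>n. \<integral>x. h x * of_bool (T x < s n) \<partial>PX) \<longlonglongrightarrow> (\<integral>x. h x * of_bool (T x < t) \<partial>PX)"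
  proof (rule integral_dominated_convergence[where w = "\<lambda>_. K"])
    show "AE x in PX. (\<lambda>n. h x * of_bool (T x < s n)) \<longlonglongrightarrow> h x * of_bool (T x < t)"
      using AE_T_neq[of t]
    proof eventually_elim
      case (elim x)
      have "eventually (\<lambda>n. (T x < s n) = (T x < t)) sequentially"
      proof (cases "T x < t")
        case True
        then show ?thesis using order_tendstoD(1)[OF s, of "T x"] by (auto elim: eventually_mono)
      next
        case False
        then show ?thesis using order_tendstoD(2)[OF s, of "T x"] elim by (auto elim!: eventually_mono)
      qed
      then show ?case by (intro tendsto_eventually) (auto elim!: eventually_mono)
    qed
    show "AE x in PX. norm (h x * of_bool (T x < s n)) \<le> K" for n
      using h(2) K by (intro AE_I2) (auto simp: of_bool_def)
  qed (auto simp: measurable_cong_sets[OF sets_PX refl])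
qed

lemma continuous_excess: "continuous_on UNIV (excess \<alpha>)"
  unfolding excess_def[abs_def]
proof (rule continuous_truncated_integral[where K = "1 + \<bar>\<alpha>\<bar>"])
  show "\<bar>T x - \<alpha>\<bar> \<le> 1 + \<bar>\<alpha>\<bar>" for x using T_bounds[of x] by simp
qed measurable

lemma Tcdf_eq: "Tcdf t = (\<integral>x. 1 * of_bool (T x < t) \<partial>PX)"
proof -
  have "Tcdf t = (\<integral>x. indicator {x. T x < t} x \<partial>PX)" by (simp add: Tcdf_def)
  also have "\<dots> = (\<integral>x. 1 * of_bool (T x < t) \<partial>PX)"
    by (intro Bochner_Integration.integral_cong) (auto simp: indicator_def)
  finally show ?thesis .
qed

lemma continuous_Tcdf: "continuous_on UNIV Tcdf"
  unfolding Tcdf_eq[abs_def] by (rule continuous_truncated_integral[where K = 1]) auto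

lemma integrable_truncated: "integrable PX (\<lambda>x. (T x - \<alpha>) * of_bool (T x < t))"
proof (rule integrable_PX[where K = "1 + \<bar>\<alpha>\<bar>"])
  show "\<bar>(T x - \<alpha>) * of_bool (T x < t)\<bar> \<le> 1 + \<bar>\<alpha>\<bar>" for x
    using T_bounds[of x] by (auto simp: of_bool_def)
qed measurable

text \<open>Centring at \<alpha> only rewrites the numerator, so \<alpha> is arbitrary; the identity
  is used with the level and with \<open>0\<close>.\<close>

lemma mFMR_star_eq: "mFMR_star F f \<theta>s t = (excess \<alpha> t + \<alpha> * Tcdf t) / Tcdf t"
proof -
  have "excess \<alpha> t + \<alpha> * Tcdf t =
      (\<integral>x. (T x - \<alpha>) * of_bool (T x < t) \<partial>PX) + (\<integral>x. \<alpha> * indicator {x. T x < t} x \<partial>PX)"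
    by (simp add: excess_def Tcdf_def)
  also have "\<dots> = (\<integral>x. (T x - \<alpha>) * of_bool (T x < t) + \<alpha> * indicator {x. T x < t} x \<partial>PX)"
    by (rule Bochner_Integration.integral_add[symmetric, OF integrable_truncated])
      (rule integrable_PX[where K = "\<bar>\<alpha>\<bar>"], auto simp: indicator_def)
  also have "\<dots> = (LINT x:{x. T x < t}|PX. T x)"
    unfolding set_lebesgue_integral_def
    by (intro Bochner_Integration.integral_cong) (auto simp: indicator_def)
  finally show ?thesis by (simp add: mFMR_star_def Tcdf_def)
qed

text \<open>Raising a threshold that stays at most \<alpha> adds only points with
  \<open>T < \<alpha>\<close>, whose contributions are negative. This later forces the oracle
  threshold above \<alpha>.\<close>

lemma excess_decreasing:
  assumes "s \<le> t" "t \<le> \<alpha>" shows "excess \<alpha> t \<le> excess \<alpha> s"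
  unfolding excess_def
  by (rule integral_mono[OF integrable_truncated integrable_truncated]) (use assms in \<open>auto simp: of_bool_def\<close>)

lemma Tcdf_1: "Tcdf 1 = 1"
proof -
  interpret PX: prob_space PX by (rule prob_space_PX)
  have "PX.prob {x \<in> space PX. T x < 1} = 1"
    by (rule PX.prob_Collect_eq_1[THEN iffD2]) (use AE_T(2) in auto)
  then show ?thesis by (simp add: Tcdf_def)
qed

text \<open>The oracle threshold \<open>t\<^sup>*\<close> is the first one beyond \<open>t\<^sub>0\<close> at which the excess risk becomes
  nonnegative.\<close>

lemma oracle_threshold:
  assumes "alpha_crit F f \<theta>s < \<alpha>" "\<alpha> < alpha_bar F f \<theta>s"
  obtains t0 ts where "0 < \<alpha>" "t0 < ts" "\<alpha> < ts" "0 < Tcdf t0" "0 \<le> excess \<alpha> ts"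
    "\<And>t. t0 \<le> t \<Longrightarrow> t < ts \<Longrightarrow> excess \<alpha> t < 0"
proof -
  interpret PX: prob_space PX by (rule prob_space_PX)
  let ?R = "{mFMR_star F f \<theta>s t |t. t \<in> {0<..1} \<and> mFMR_star F f \<theta>s t > 0}"
  have bar: "alpha_bar F f \<theta>s = excess \<alpha> 1 + \<alpha>"
    unfolding alpha_bar_def mFMR_star_eq[of 1 \<alpha>] Tcdf_1 by simp
  have ex1: "0 < excess \<alpha> 1" using assms(2) bar by simp
  \<comment> \<open>\<open>T\<close> is positive almost surely, hence so is its mean. This shows
    that the set behind \<open>alpha_crit\<close> is nonempty, which makes its infimum
    meaningful.\<close>
  have "0 < (\<integral>x. (T x - 0) * of_bool (T x < 1) \<partial>PX)"
  proof -
    have "(\<integral>x. (T x - 0) * of_bool (T x < 1) \<partial>PX) \<noteq> 0"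
    proof
      assume "(\<integral>x. (T x - 0) * of_bool (T x < 1) \<partial>PX) = 0"
      then have "AE x in PX. (T x - 0) * of_bool (T x < 1) = 0"
        using integral_nonneg_eq_0_iff_AE[OF integrable_truncated[of 0 1]] T_bounds(1) by simp
      with AE_T have "AE x in PX. False" by eventually_elim simp
      then show False by simp
    qed
    moreover have "0 \<le> (\<integral>x. (T x - 0) * of_bool (T x < 1) \<partial>PX)"
      using T_bounds(1) by (intro Bochner_Integration.integral_nonneg) simp
    ultimately show ?thesis by simp
  qed
  then have "0 < mFMR_star F f \<theta>s 1"
    unfolding mFMR_star_eq[of 1 0] Tcdf_1 by (simp add: excess_def)
  then have "mFMR_star F f \<theta>s 1 \<in> ?R" by auto
  then obtain t0 where t0: "t0 \<in> {0<..1}" "0 < mFMR_star F f \<theta>s t0" "mFMR_star F f \<theta>s t0 < \<alpha>"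
    using cInf_lessD[of ?R \<alpha>] assms(1) unfolding alpha_crit_def by auto
  then have \<alpha>: "0 < \<alpha>" by linarith
  \<comment> \<open>On an event of probability \<open>0\<close> the quotient would be
    \<open>0\<close>, contrary to the positive value of \<open>mFMR_star\<close> at
    \<open>t0\<close>.\<close>
  have cdf0: "0 < Tcdf t0"
    using t0(2) by (cases "Tcdf t0 = 0") (auto simp: mFMR_star_def Tcdf_def zero_less_measure_iff less_le)
  have ex0: "excess \<alpha> t0 < 0"
    using t0(3) cdf0 unfolding mFMR_star_eq[of t0 \<alpha>] by (simp add: divide_less_eq)
  \<comment> \<open>Compactness yields a smallest threshold with nonnegative excess;
    \<open>1\<close> belongs to \<open>J\<close> because the excess there is
    \<open>alpha_bar - \<alpha>\<close>.\<close>
  define J where "J = {t0..1} \<inter> excess \<alpha> -` {0..}"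
  have "closed (excess \<alpha> -` {0..})"
    using continuous_closed_vimage[of "{0..}" "excess \<alpha>"] continuous_excess[of \<alpha>]
    by (simp add: continuous_on_eq_continuous_at)
  then have "compact J" unfolding J_def by (intro compact_Int_closed) auto
  moreover have "1 \<in> J" using t0(1) ex1 by (simp add: J_def)
  ultimately obtain ts where ts: "ts \<in> J" "\<forall>t\<in>J. ts \<le> t"
    using compact_attains_inf[of J] by blast
  have below: "excess \<alpha> t < 0" if "t0 \<le> t" "t < ts" for t
  proof (rule ccontr)
    assume "\<not> excess \<alpha> t < 0"
    then have "t \<in> J" using that ts(1) by (auto simp: J_def)
    then show False using ts(2) that(2) by auto
  qed
  have "t0 \<le> ts" "t0 \<noteq> ts" "0 \<le> excess \<alpha> ts" using ts(1) ex0 by (auto simp: J_def)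
  \<comment> \<open>Up to \<alpha> the excess only decreases from its negative value at
    \<open>t0\<close>, so it cannot have become nonnegative by then.\<close>
  moreover have "\<alpha> < ts"
    using excess_decreasing[of t0 ts \<alpha>] ex0 calculation by force
  ultimately show thesis using that[of t0 ts] \<alpha> cdf0 below by simp
qed

end

section \<open>The plug-in procedure\<close>

locale plugin_estimator = continuous_mixture M U F f \<theta>s Z X
  for M :: "'w measure" and U :: "'u::euclidean_space set" and F :: "'u \<Rightarrow> (real ^ 'd) measure"
    and f and \<theta>s :: "('q::finite, 'u) param" and Z and X +
  fixes D :: "('q, 'u) param set"
    and \<theta>hat :: "nat \<Rightarrow> (nat \<Rightarrow> real ^ 'd) \<Rightarrow> ('q, 'u) param"
    and \<alpha> :: real
    and Cpi :: "nat \<Rightarrow> ('q, 'd) proc"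
  assumes continuous_family: "AE x in obs_law F \<theta>s. continuous_on U (\<lambda>u. f u x)"
    and countable_D: "countable D" and D_valid: "D \<subseteq> valid_params U"
    and estimator_measurable: "\<And>n. \<theta>hat n \<in> data_space n \<rightarrow>\<^sub>M borel"
    and estimator_in_D: "\<And>n x. x \<in> space (data_space n) \<Longrightarrow> \<theta>hat n x \<in> D"
    and consistent: "\<And>\<epsilon>. 0 < \<epsilon> \<Longrightarrow> (\<lambda>n. measure M {\<omega> \<in> space M.
          (MIN \<sigma>\<in>{\<sigma>. \<sigma> permutes UNIV}. norm (permuted \<sigma> (\<theta>hat n (data X n \<omega>)) - \<theta>s)) \<ge> \<epsilon>})
          \<longlonglongrightarrow> 0"
    and level: "alpha_crit F f \<theta>s < \<alpha>" "\<alpha> < alpha_bar F f \<theta>s"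
    and plugin_procedure: "\<And>n. procedure n (Cpi n)"
    and plugin: "\<And>n. is_plugin f \<alpha> n (\<theta>hat n) (Cpi n)"
begin

section \<open>The envelope of the posterior probabilities near the true parameter\<close>

lemma level_pos: "0 < \<alpha>"
  using oracle_threshold[OF level] by metis

text \<open>Consistency brings only some relabelling of the estimate close to
  \<open>\<theta>s\<close>, so the envelope has to range over all relabelled values.\<close>

definition "DP = (\<Union>\<sigma>\<in>{\<sigma>. \<sigma> permutes UNIV}. permuted \<sigma> ` D)"

lemma countable_DP: "countable DP"
  unfolding DP_def using countable_D by (intro countable_UN countable_finite[OF finite_perms] countable_image)

lemma DP_valid: "DP \<subseteq> valid_params U"
  unfolding DP_def using D_valid permuted_valid by blast

text \<open>Since the estimator has countable range, the local oscillation of the posterior probabilities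
  around \<open>\<theta>\<^sup>*\<close> is a measurable envelope. Its mean tends to \<open>0\<close> with \<open>r\<close>, and this bound on the means
  replaces a uniform law of large numbers.\<close>

definition env :: "real \<Rightarrow> real ^ 'd \<Rightarrow> real" where
  "env r x = (SUP \<theta>\<in>insert \<theta>s (DP \<inter> ball \<theta>s r). post_dist f x \<theta> \<theta>s)"

lemma env_index_valid: "insert \<theta>s (DP \<inter> ball \<theta>s r) \<subseteq> valid_params U"
  using DP_valid valid by auto

lemma env_bdd: "bdd_above ((\<lambda>\<theta>. post_dist f x \<theta> \<theta>s) ` insert \<theta>s (DP \<inter> ball \<theta>s r))"
  using env_index_valid[of r] post_dist_bounds(2)[OF _ valid] by (intro bdd_aboveI2) blast

lemma env_measurable [measurable]: "env r \<in> borel_measurable borel"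
  unfolding env_def[abs_def]
proof (rule borel_measurable_cSUP)
  show "countable (insert \<theta>s (DP \<inter> ball \<theta>s r))" using countable_DP by simp
  show "(\<lambda>x. post_dist f x \<theta> \<theta>s) \<in> borel_measurable borel" if "\<theta> \<in> insert \<theta>s (DP \<inter> ball \<theta>s r)" for \<theta>
    by (rule post_dist_measurable[OF _ valid]) (use that env_index_valid in blast)
qed (rule env_bdd)

lemma env_upper:
  assumes "\<theta> \<in> DP" "dist \<theta>s \<theta> < r" shows "post_dist f x \<theta> \<theta>s \<le> env r x"
  unfolding env_def using assms by (intro cSUP_upper env_bdd) auto

text \<open>The countable index set is enlarged to all nearby valid parameters, where continuity in
  the parameter can be used.\<close>

lemma env_least:
  assumes "\<And>\<theta>. \<theta> \<in> valid_params U \<Longrightarrow> dist \<theta>s \<theta> < r \<Longrightarrow> post_dist f x \<theta> \<theta>s \<le> e" "0 \<le> e"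
  shows "env r x \<le> e"
  unfolding env_def using assms DP_valid by (intro cSUP_least) (auto simp: post_dist_def)

text \<open>The index set contains \<open>\<theta>s\<close>, where the distance is \<open>0\<close>;
  this keeps the supremum meaningful and nonnegative when no relabelled estimate is near.\<close>

lemma env_bounds: "0 \<le> env r x" "env r x \<le> real CARD('q)"
proof -
  have "post_dist f x \<theta>s \<theta>s \<le> env r x" unfolding env_def by (intro cSUP_upper env_bdd) simp
  then show "0 \<le> env r x" by (simp add: post_dist_def)
  show "env r x \<le> real CARD('q)" by (rule env_least) (auto intro: post_dist_bounds[OF _ valid])
qed

lemma env_abs: "\<bar>env r x\<bar> \<le> real CARD('q)"
  using env_bounds[of r x] by simp

text \<open>Dominated convergence along the radii \<open>1 / (m + 1)\<close>: at almost every
  \<open>x\<close> the posterior probabilities are continuous at \<open>\<theta>s\<close>, so the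
  envelope tends to \<open>0\<close>, and the number of classes dominates it.\<close>

lemma integral_env_small:
  assumes "0 < e"
  obtains r where "0 < r" "(\<integral>x. env r x \<partial>PX) < e"
proof -
  interpret PX: prob_space PX by (rule prob_space_PX)
  have "(\<lambda>m. \<integral>x. env (1 / real (Suc m)) x \<partial>PX) \<longlonglongrightarrow> (\<integral>x. 0 \<partial>PX)"
  proof (rule integral_dominated_convergence[where w = "\<lambda>_. real CARD('q)"])
    show "AE x in PX. (\<lambda>m. env (1 / real (Suc m)) x) \<longlonglongrightarrow> 0"
      using continuous_family AE_mix_density_pos
    proof eventually_elim
      case (elim x)
      show ?case
      proof (rule LIMSEQ_I)
        fix e :: real assume e: "0 < e"
        have "((\<lambda>\<theta>. post_dist f x \<theta> \<theta>s) \<longlongrightarrow> 0) (at \<theta>s within valid_params U)"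
          using elim valid by (intro post_dist_tendsto_0) auto
        \<comment> \<open>Half of \<open>e\<close>, since a supremum of values below a bound may
          equal it.\<close>
        then have "eventually (\<lambda>\<theta>. post_dist f x \<theta> \<theta>s < e / 2) (at \<theta>s within valid_params U)"
          using e by (intro order_tendstoD(2)) auto
        then obtain d where d: "0 < d" "\<And>\<theta>. \<theta> \<in> valid_params U \<Longrightarrow> \<theta> \<noteq> \<theta>s \<Longrightarrow> dist \<theta> \<theta>s < d \<Longrightarrow>
            post_dist f x \<theta> \<theta>s < e / 2"
          unfolding eventually_at by blast
        have env: "env r x < e" if "r \<le> d" for r
        proof -
          have "env r x \<le> e / 2"
          proof (rule env_least)
            fix \<theta> assume "\<theta> \<in> valid_params U" "dist \<theta>s \<theta> < r"
            \<comment> \<open>The limit ignores \<open>\<theta>s\<close> itself, but there the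
              distance is \<open>0\<close>.\<close>
            then show "post_dist f x \<theta> \<theta>s \<le> e / 2"
              using d(2)[of \<theta>] that e by (cases "\<theta> = \<theta>s") (auto simp: post_dist_def dist_commute)
          qed (use e in simp)
          then show ?thesis using e by simp
        qed
        obtain m0 where m0: "1 / real (Suc m0) < d" using nat_approx_posE[OF d(1)] .
        have "norm (env (1 / real (Suc m)) x - 0) < e" if "m0 \<le> m" for m
        proof -
          have "1 / real (Suc m) \<le> 1 / real (Suc m0)" using that by (intro divide_left_mono) auto
          then show ?thesis using env[of "1 / real (Suc m)"] m0 env_bounds(1)[of "1 / real (Suc m)" x] by simp
        qed
        then show "\<exists>m0. \<forall>m\<ge>m0. norm (env (1 / real (Suc m)) x - 0) < e" by blast
      qed
    qed
    show "AE x in PX. norm (env (1 / real (Suc m)) x) \<le> real CARD('q)" for m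
      using env_abs by simp
  qed (auto simp: measurable_cong_sets[OF sets_PX refl])
  then have "eventually (\<lambda>m. (\<integral>x. env (1 / real (Suc m)) x \<partial>PX) < e) sequentially"
    using assms by (intro order_tendstoD(2)) auto
  then obtain m where "(\<integral>x. env (1 / real (Suc m)) x \<partial>PX) < e"
    unfolding eventually_sequentially by blast
  then show thesis by (intro that[of "1 / real (Suc m)"]) auto
qed

section \<open>The plug-in rule on samples where the estimator is close\<close>

lemma integrable_indicator_event: "A \<in> sets M \<Longrightarrow> integrable M (indicat_real A)"
  by (intro integrable_const_bound[where B = 1]) (auto simp: indicator_def)

definition "bad n r = {\<omega> \<in> space M.
  (MIN \<sigma>\<in>{\<sigma>. \<sigma> permutes UNIV}. norm (permuted \<sigma> (\<theta>hat n (data X n \<omega>)) - \<theta>s)) \<ge> r}"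

lemma bad_measurable [measurable]: "bad n r \<in> sets M"
proof -
  have "(\<lambda>\<theta> :: ('q, 'u) param. norm (permuted \<sigma> \<theta> - \<theta>s)) \<in> borel_measurable borel" for \<sigma>
    unfolding permuted_def
    by (intro borel_measurable_continuous_onI continuous_intros)
  then have "(\<lambda>\<omega>. norm (permuted \<sigma> (\<theta>hat n (data X n \<omega>)) - \<theta>s)) \<in> borel_measurable M" for \<sigma>
    using measurable_compose[OF measurable_compose[OF data_measurable estimator_measurable]] by blast
  then have [measurable]: "(\<lambda>\<omega>. MIN \<sigma>\<in>{\<sigma>. \<sigma> permutes UNIV}. norm (permuted \<sigma> (\<theta>hat n (data X n \<omega>)) - \<theta>s))
      \<in> borel_measurable M"
    by (intro borel_measurable_Min finite_perms)
  show ?thesis unfolding bad_def by measurable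
qed

lemma prob_bad: "0 < r \<Longrightarrow> (\<lambda>n. prob (bad n r)) \<longlonglongrightarrow> 0"
  unfolding bad_def by (rule consistent)

abbreviation "That n \<omega> i \<equiv> Tstat f (X i \<omega>) (\<theta>hat n (data X n \<omega>))"

abbreviation "Shat n \<omega> \<equiv> snd (Cpi n) (data X n \<omega>)"

text \<open>One permutation serves all points \<open>x\<close> at once, as it must: the risk allows
  a single relabelling for the whole sample.\<close>

lemma good_permutation:
  assumes "\<omega> \<in> space M" "\<omega> \<notin> bad n r"
  obtains \<sigma> where "\<sigma> permutes UNIV"
    "\<And>x. post_dist f x (permuted \<sigma> (\<theta>hat n (data X n \<omega>))) \<theta>s \<le> env r x"
proof -
  let ?N = "\<lambda>\<sigma>. norm (permuted \<sigma> (\<theta>hat n (data X n \<omega>)) - \<theta>s)"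
  have "(MIN \<sigma>\<in>{\<sigma>. \<sigma> permutes UNIV}. ?N \<sigma>) \<in> ?N ` {\<sigma>. \<sigma> permutes UNIV}"
    using finite_perms by (intro Min_in) (auto intro: permutes_id)
  then obtain \<sigma> where \<sigma>: "\<sigma> permutes UNIV" "(MIN \<sigma>\<in>{\<sigma>. \<sigma> permutes UNIV}. ?N \<sigma>) = ?N \<sigma>"
    by blast
  have "?N \<sigma> < r" using assms \<sigma>(2) by (simp add: bad_def)
  then have "dist \<theta>s (permuted \<sigma> (\<theta>hat n (data X n \<omega>))) < r" by (simp add: dist_norm norm_minus_commute)
  moreover have "permuted \<sigma> (\<theta>hat n (data X n \<omega>)) \<in> DP"
    unfolding DP_def using \<sigma>(1) estimator_in_D[OF data_in_space[OF assms(1)]] by blast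
  ultimately show thesis using that[OF \<sigma>(1)] env_upper by blast
qed

text \<open>Passes from the data vector to the variables \<open>X i\<close>, with which it agrees on
  \<open>{1..n}\<close>. The last bound holds however ties are broken, because the sum over the
  selection is the sum of the smallest statistics.\<close>

lemma plugin_facts:
  assumes "\<omega> \<in> space M"
  shows "\<And>i. i \<in> {1..n} \<Longrightarrow> That n \<omega> i = 1 - post f (fst (Cpi n) (data X n \<omega>) i) (X i \<omega>) (\<theta>hat n (data X n \<omega>))"
    and "Shat n \<omega> \<subseteq> {1..n}"
    and "card (Shat n \<omega>) = khat \<alpha> n (That n \<omega>)"
    and "(\<Sum>i\<in>Shat n \<omega>. That n \<omega> i) \<le> \<alpha> * real (card (Shat n \<omega>))"
proof -
  let ?x = "data X n \<omega>" and ?t = "\<lambda>i. Tstat f (data X n \<omega> i) (\<theta>hat n (data X n \<omega>))"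
  have x: "?x i = X i \<omega>" if "i \<in> {1..n}" for i using that by (simp add: data_def)
  have P: "\<forall>i\<in>{1..n}. is_arg_max (\<lambda>q. post f q (?x i) (\<theta>hat n ?x)) (\<lambda>_. True) (fst (Cpi n) ?x i)"
    "snd (Cpi n) ?x \<subseteq> {1..n}" "card (snd (Cpi n) ?x) = khat \<alpha> n ?t"
    "\<forall>i\<in>snd (Cpi n) ?x. \<forall>j\<in>{1..n} - snd (Cpi n) ?x. ?t i \<le> ?t j"
    using plugin[of n] data_in_space[OF assms, of n] unfolding is_plugin_def by blast+
  show "That n \<omega> i = 1 - post f (fst (Cpi n) ?x i) (X i \<omega>) (\<theta>hat n ?x)" if "i \<in> {1..n}" for i
    using P(1) that x[OF that] Tstat_eq_arg_max by metis
  show sub: "Shat n \<omega> \<subseteq> {1..n}" by (rule P(2))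
  have "order_stat n ?t j = order_stat n (That n \<omega>) j" for j
  proof -
    have "map ?t [1..<Suc n] = map (That n \<omega>) [1..<Suc n]"
      by (intro map_cong refl) (auto simp: x simp del: upt_Suc)
    then show ?thesis unfolding order_stat_def by (simp only:)
  qed
  then have os: "order_stat n ?t = order_stat n (That n \<omega>)" ..
  then show card: "card (Shat n \<omega>) = khat \<alpha> n (That n \<omega>)" using P(3) by (simp add: khat_def)
  have "(\<Sum>i\<in>Shat n \<omega>. That n \<omega> i) = (\<Sum>j=1..card (Shat n \<omega>). order_stat n (That n \<omega>) j)"
  proof (rule sum_smallest_eq_order_stat[OF sub])
    fix i j assume "i \<in> Shat n \<omega>" "j \<in> {1..n} - Shat n \<omega>"
    then show "That n \<omega> i \<le> That n \<omega> j" using P(4) sub x[of i] x[of j] by force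
  qed
  also have "\<dots> \<le> \<alpha> * real (card (Shat n \<omega>))"
    unfolding card using level_pos by (intro sum_order_stat_khat_le) simp
  finally show "(\<Sum>i\<in>Shat n \<omega>. That n \<omega> i) \<le> \<alpha> * real (card (Shat n \<omega>))" .
qed

text \<open>The indices with \<open>T < t\<close> form a candidate for \<open>khat\<close>: their
  mean estimated statistic is at most \<alpha> as soon as the true excess and the envelope together
  sum to at most \<open>0\<close>. \<open>Tstat\<close> is invariant under relabelling, so the
  permutation drops out.\<close>

lemma card_Shat_ge:
  assumes \<omega>: "\<omega> \<in> space M" "\<omega> \<notin> bad n r"
    and le: "(\<Sum>i=1..n. (T (X i \<omega>) - \<alpha>) * of_bool (T (X i \<omega>) < t) + env r (X i \<omega>)) \<le> 0"
  shows "(\<Sum>i=1..n. of_bool (T (X i \<omega>) < t)) \<le> real (card (Shat n \<omega>))"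
proof -
  obtain \<sigma> where \<sigma>: "\<sigma> permutes UNIV"
    "\<And>x. post_dist f x (permuted \<sigma> (\<theta>hat n (data X n \<omega>))) \<theta>s \<le> env r x"
    using good_permutation[OF \<omega>] by blast
  have That: "That n \<omega> i \<le> T (X i \<omega>) + env r (X i \<omega>)" for i
    using Tstat_diff_le[of f "X i \<omega>" "permuted \<sigma> (\<theta>hat n (data X n \<omega>))" \<theta>s] \<sigma>(2)[of "X i \<omega>"]
    by (simp add: Tstat_permuted[OF \<sigma>(1)])
  define A where "A = {i \<in> {1..n}. T (X i \<omega>) < t}"
  have A: "A \<subseteq> {1..n}" "finite A" by (auto simp: A_def)
  have A_sum: "(\<Sum>i=1..n. of_bool (T (X i \<omega>) < t) * g i) = sum g A" for g :: "nat \<Rightarrow> real"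
    unfolding A_def by (intro sum.mono_neutral_cong_right) auto
  have "(\<Sum>i\<in>A. That n \<omega> i - \<alpha>) \<le> (\<Sum>i\<in>A. T (X i \<omega>) - \<alpha>) + (\<Sum>i\<in>A. env r (X i \<omega>))"
    unfolding sum.distrib[symmetric] using That by (intro sum_mono) (simp add: algebra_simps)
  also have "(\<Sum>i\<in>A. env r (X i \<omega>)) \<le> (\<Sum>i=1..n. env r (X i \<omega>))"
    using A env_bounds(1) by (intro sum_mono2) auto
  also have "(\<Sum>i\<in>A. T (X i \<omega>) - \<alpha>) + (\<Sum>i=1..n. env r (X i \<omega>)) \<le> 0"
    using le by (simp add: sum.distrib A_sum[symmetric] mult.commute)
  finally have "sum (That n \<omega>) A \<le> \<alpha> * real (card A)" by (simp add: sum_subtractf mult.commute)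
  then have "card A \<le> card (Shat n \<omega>)"
    using khat_ge[OF A(1)] level_pos plugin_facts(3)[OF \<omega>(1)] by simp
  moreover have "(\<Sum>i=1..n. of_bool (T (X i \<omega>) < t)) = real (card A)"
    using A_sum[of "\<lambda>_. 1"] by simp
  ultimately show ?thesis by simp
qed

text \<open>Label \<open>q\<close> at the estimate is label \<open>inv \<sigma> q\<close> at the
  relabelled estimate, which is close to \<open>\<theta>s\<close>. The selection keeps its mean
  estimated error below \<alpha>, and the envelope pays for the passage to the true error.\<close>

lemma loss_plugin_le:
  assumes \<omega>: "\<omega> \<in> space M" "\<omega> \<notin> bad n r"
  obtains \<tau> where "\<tau> permutes UNIV"
    "loss n (Cpi n) \<tau> \<omega> \<le> \<alpha> * real (card (Shat n \<omega>)) + (\<Sum>i=1..n. env r (X i \<omega>))"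
proof -
  obtain \<sigma> where \<sigma>: "\<sigma> permutes UNIV"
    "\<And>x. post_dist f x (permuted \<sigma> (\<theta>hat n (data X n \<omega>))) \<theta>s \<le> env r x"
    using good_permutation[OF \<omega>] by blast
  let ?\<theta> = "\<theta>hat n (data X n \<omega>)"
  let ?z = "fst (Cpi n) (data X n \<omega>)"
  have "1 - post f (inv \<sigma> (?z i)) (X i \<omega>) \<theta>s \<le> That n \<omega> i + env r (X i \<omega>)" if "i \<in> {1..n}" for i
    using abs_post_diff_le[of f "inv \<sigma> (?z i)" "X i \<omega>" "permuted \<sigma> ?\<theta>" \<theta>s] \<sigma>(2)[of "X i \<omega>"]
      plugin_facts(1)[OF \<omega>(1) that]
    by (simp add: post_permuted[OF \<sigma>(1)] permutes_inverses(1)[OF \<sigma>(1)])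
  then have "loss n (Cpi n) (inv \<sigma>) \<omega> \<le> (\<Sum>i\<in>Shat n \<omega>. That n \<omega> i + env r (X i \<omega>))"
    unfolding loss_def using plugin_facts(2)[OF \<omega>(1)] by (intro sum_mono) blast
  also have "\<dots> = (\<Sum>i\<in>Shat n \<omega>. That n \<omega> i) + (\<Sum>i\<in>Shat n \<omega>. env r (X i \<omega>))"
    by (rule sum.distrib)
  \<comment> \<open>The selected set depends on the estimator, so the envelope is summed over the
    whole sample, where the sum has a known mean.\<close>
  also have "\<dots> \<le> \<alpha> * real (card (Shat n \<omega>)) + (\<Sum>i=1..n. env r (X i \<omega>))"
    using plugin_facts(2,4)[OF \<omega>(1)] env_bounds(1) by (intro add_mono sum_mono2) auto
  finally show thesis using that[OF permutes_inv[OF \<sigma>(1)]] by blast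
qed

section \<open>Bounds for the plug-in rule at a fixed sample size\<close>

abbreviation "drift r t x \<equiv> (T x - \<alpha>) * of_bool (T x < t) + env r x"

lemma drift_measurable: "drift r t \<in> borel_measurable borel"
  by measurable

lemma drift_bound: "\<bar>drift r t x\<bar> \<le> 1 + \<bar>\<alpha>\<bar> + real CARD('q)"
  using T_bounds[of x] env_bounds[of r x] by (auto simp: of_bool_def)

lemma integral_drift: "(\<integral>x. drift r t x \<partial>PX) = excess \<alpha> t + (\<integral>x. env r x \<partial>PX)"
  unfolding excess_def
  by (rule Bochner_Integration.integral_add[OF integrable_truncated integrable_PX[OF env_measurable env_abs]])

text \<open>Outside this event and \<open>bad\<close>, \<open>card_Shat_ge\<close> applies. The
  event is unlikely once the mean envelope is smaller than the gap between the excess at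
  \<open>t\<close> and \<open>0\<close>.\<close>

definition "overshoot n r t = {\<omega> \<in> space M. 0 < (\<Sum>i=1..n. drift r t (X i \<omega>))}"

lemma overshoot_measurable [measurable]: "overshoot n r t \<in> sets M"
proof -
  have [measurable]: "(\<lambda>\<omega>. \<Sum>i=1..n. drift r t (X i \<omega>)) \<in> borel_measurable M"
    using integrable_sum_X[OF drift_measurable drift_bound] by (rule borel_measurable_integrable)
  show ?thesis unfolding overshoot_def by measurable
qed

lemma prob_overshoot:
  assumes "excess \<alpha> t + (\<integral>x. env r x \<partial>PX) < 0"
  shows "(\<lambda>n. prob (overshoot n r t)) \<longlonglongrightarrow> 0"
  unfolding overshoot_def
  using assms by (intro prob_sum_pos_tendsto_0[OF drift_measurable drift_bound]) (simp add: integral_drift)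

text \<open>Off the two exceptional events the selection is at least as large as the number of
  observations with \<open>T < t\<close>. On them that number is bounded by \<open>n\<close>, which
  costs \<open>n\<close> times their probability.\<close>

lemma exp_selected_plugin_ge:
  "real n * (Tcdf t - prob (bad n r) - prob (overshoot n r t)) \<le> exp_selected M X n (Cpi n)"
proof -
  have h: "(\<lambda>x. of_bool (T x < t) :: real) \<in> borel_measurable borel" "\<bar>of_bool (T x < t) :: real\<bar> \<le> 1" for x
    by auto
  note int = integrable_sum_X[OF h, where n = n]
  let ?k = "\<lambda>\<omega>. real (card (Shat n \<omega>))"
  let ?b = "\<lambda>\<omega>. ?k \<omega> + (real n * indicator (bad n r) \<omega> + real n * indicator (overshoot n r t) \<omega>)"
  have intk: "integrable M ?k" by (rule integrable_card_selected[OF plugin_procedure])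
  have intb: "integrable M ?b"
    using intk by (intro Bochner_Integration.integrable_add) (auto intro: integrable_indicator_event)
  have "real n * Tcdf t = expectation (\<lambda>\<omega>. \<Sum>i=1..n. of_bool (T (X i \<omega>) < t))"
    using expectation_sum_X[OF h, where n = n] by (simp add: Tcdf_eq)
  also have "\<dots> \<le> expectation ?b"
  proof (rule integral_mono[OF int intb])
    fix \<omega> assume \<omega>: "\<omega> \<in> space M"
    have le: "(\<Sum>i=1..n. of_bool (T (X i \<omega>) < t)) \<le> real n"
      using sum_bounded_above[of "{1..n}" "\<lambda>i. of_bool (T (X i \<omega>) < t) :: real" 1] by simp
    show "(\<Sum>i=1..n. of_bool (T (X i \<omega>) < t)) \<le> ?b \<omega>"
    proof (cases "\<omega> \<in> bad n r \<or> \<omega> \<in> overshoot n r t")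
      case True
      then have "real n \<le> ?b \<omega>" by (auto simp: indicator_def)
      then show ?thesis using le by linarith
    next
      case False
      then show ?thesis using card_Shat_ge[OF \<omega>, of n r t] \<omega> by (simp add: overshoot_def not_less)
    qed
  qed
  also have "expectation ?b = exp_selected M X n (Cpi n) + (real n * prob (bad n r) + real n * prob (overshoot n r t))"
    using intk by (simp add: exp_selected_def integrable_indicator_event bad_measurable overshoot_measurable)
  finally show ?thesis by (simp add: algebra_simps)
qed

text \<open>Numerator and denominator of the mFMR are averaged separately, so the envelope enters
  through its exact expectation. On \<open>bad\<close> the loss is bounded by
  \<open>n\<close>.\<close>

lemma cond_risk_plugin_le:
  "expectation (cond_risk n (Cpi n) (\<lambda>_. 1)) \<le>
    \<alpha> * exp_selected M X n (Cpi n) + real n * ((\<integral>x. env r x \<partial>PX) + prob (bad n r))"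
proof -
  let ?k = "\<lambda>\<omega>. real (card (Shat n \<omega>))"
  let ?b = "\<lambda>\<omega>. \<alpha> * ?k \<omega> + ((\<Sum>i=1..n. env r (X i \<omega>)) + real n * indicator (bad n r) \<omega>)"
  have intk: "integrable M ?k" by (rule integrable_card_selected[OF plugin_procedure])
  have inte: "integrable M (\<lambda>\<omega>. \<Sum>i=1..n. env r (X i \<omega>))" by (rule integrable_sum_X[OF env_measurable env_abs])
  have "AE \<omega> in M. cond_risk n (Cpi n) (\<lambda>_. 1) \<omega> \<le> ?b \<omega>"
    using cond_risk_le[OF plugin_procedure, of "\<lambda>_. 1" n 1, simplified] AE_space
  proof eventually_elim
    case (elim \<omega>)
    have e: "0 \<le> (\<Sum>i=1..n. env r (X i \<omega>))" using env_bounds(1) by (intro sum_nonneg) auto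
    show ?case
    proof (cases "\<omega> \<in> bad n r")
      case True
      have "cond_risk n (Cpi n) (\<lambda>_. 1) \<omega> \<le> loss n (Cpi n) id \<omega>" using elim(1) permutes_id by blast
      also have "\<dots> \<le> real n"
        using loss_bounds(3)[of n "Cpi n" id \<omega>] card_selected_le[OF plugin_procedure elim(2), of n] by simp
      finally show ?thesis using True e level_pos by (simp add: add_increasing)
    next
      case False
      obtain \<tau> where "\<tau> permutes UNIV"
        "loss n (Cpi n) \<tau> \<omega> \<le> \<alpha> * ?k \<omega> + (\<Sum>i=1..n. env r (X i \<omega>))"
        using loss_plugin_le[OF elim(2) False] by blast
      moreover from this have "cond_risk n (Cpi n) (\<lambda>_. 1) \<omega> \<le> loss n (Cpi n) \<tau> \<omega>" using elim(1) by blast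
      ultimately show ?thesis using False by simp
    qed
  qed
  then have "expectation (cond_risk n (Cpi n) (\<lambda>_. 1)) \<le> expectation ?b"
    using intk inte integrable_cond_risk[OF plugin_procedure, of "\<lambda>_. 1" n 1]
    by (intro integral_mono_AE Bochner_Integration.integrable_add) (auto intro: integrable_indicator_event)
  also have "\<dots> = \<alpha> * exp_selected M X n (Cpi n) + (real n * (\<integral>x. env r x \<partial>PX) + real n * prob (bad n r))"
    using intk inte
    by (simp add: exp_selected_def expectation_sum_X[OF env_measurable env_abs]
        integrable_indicator_event bad_measurable)
  finally show ?thesis by (simp add: algebra_simps)
qed

text \<open>The FMR has its random denominator inside the expectation, so the selection size has to
  be bounded below on most samples and not merely on average, as it is for the mFMR.\<close>

definition "undershoot n (c :: real) t = {\<omega> \<in> space M. 0 < (\<Sum>i=1..n. c - of_bool (T (X i \<omega>) < t))}"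

lemma undershoot_summand:
  "(\<lambda>x. (c :: real) - of_bool (T x < t)) \<in> borel_measurable borel"
  "\<bar>(c :: real) - of_bool (T x < t)\<bar> \<le> \<bar>c\<bar> + 1"
  by (auto simp: of_bool_def)

lemma undershoot_measurable [measurable]: "undershoot n c t \<in> sets M"
proof -
  have [measurable]: "(\<lambda>\<omega>. \<Sum>i=1..n. c - of_bool (T (X i \<omega>) < t)) \<in> borel_measurable M"
    using integrable_sum_X[OF undershoot_summand] by (rule borel_measurable_integrable)
  show ?thesis unfolding undershoot_def by measurable
qed

lemma prob_undershoot:
  assumes "c < Tcdf t"
  shows "(\<lambda>n. prob (undershoot n c t)) \<longlonglongrightarrow> 0"
  unfolding undershoot_def
proof (rule prob_sum_pos_tendsto_0[OF undershoot_summand])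
  interpret PX: prob_space PX by (rule prob_space_PX)
  have "integrable PX (\<lambda>x. of_bool (T x < t) :: real)" by (rule integrable_PX[where K = 1]) auto
  then have "(\<integral>x. c - of_bool (T x < t) \<partial>PX) = c - (\<integral>x. of_bool (T x < t) \<partial>PX)"
    by (subst Bochner_Integration.integral_diff) (auto simp: PX.prob_space[simplified])
  then show "(\<integral>x. c - of_bool (T x < t) \<partial>PX) < 0"
    using assms Tcdf_eq[of t] by simp
qed

text \<open>Off the three events at least \<open>c * n\<close> observations are selected, so the
  envelope sum divided by the selection size is at most its sample average divided by
  \<open>c\<close>. On them the ratio is bounded by \<open>1\<close>.\<close>

lemma FMR_plugin_le:
  assumes c: "0 < c" and n: "1 \<le> n"
  shows "FMR M Z X n (Cpi n) \<le> \<alpha> + (\<integral>x. env r x \<partial>PX) / c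
    + (prob (bad n r) + (prob (overshoot n r t) + prob (undershoot n c t)))"
proof -
  let ?k = "\<lambda>\<omega>. card (Shat n \<omega>)"
  let ?w = "\<lambda>x. 1 / real (max (card (snd (Cpi n) x)) 1)"
  let ?e = "\<lambda>\<omega>. \<Sum>i=1..n. env r (X i \<omega>)"
  let ?b = "\<lambda>\<omega>. \<alpha> + 1 / (c * real n) * ?e \<omega> + (indicator (bad n r) \<omega> +
    (indicator (overshoot n r t) \<omega> + indicator (undershoot n c t) \<omega>))"
  have w: "?w \<in> borel_measurable (data_space n)"
  proof -
    have "snd (Cpi n) \<in> data_space n \<rightarrow>\<^sub>M count_space (Pow {1..n})" using plugin_procedure by (simp add: procedure_def)
    from measurable_compose[OF this, of "\<lambda>S. 1 / real (max (card S) 1)" borel] show ?thesis by simp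
  qed
  have wb: "\<forall>x\<in>space (data_space n). \<bar>?w x\<bar> \<le> 1" by (simp add: divide_le_eq)
  have inte: "integrable M ?e" by (rule integrable_sum_X[OF env_measurable env_abs])
  have "AE \<omega> in M. cond_risk n (Cpi n) ?w \<omega> \<le> ?b \<omega>"
    using cond_risk_le[OF plugin_procedure w wb] AE_space
  proof eventually_elim
    case (elim \<omega>)
    have e: "0 \<le> ?e \<omega>" using env_bounds(1) by (intro sum_nonneg) auto
    then have e': "0 \<le> 1 / (c * real n) * ?e \<omega>" using c by (intro mult_nonneg_nonneg) auto
    show ?case
    proof (cases "\<omega> \<in> bad n r \<or> \<omega> \<in> overshoot n r t \<or> \<omega> \<in> undershoot n c t")
      case True
      have "cond_risk n (Cpi n) ?w \<omega> \<le> ?w (data X n \<omega>) * loss n (Cpi n) id \<omega>"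
        using elim(1) permutes_id by blast
      also have "\<dots> \<le> 1"
      proof -
        have "loss n (Cpi n) id \<omega> \<le> real (max (?k \<omega>) 1)"
          using loss_bounds(3)[of n "Cpi n" id \<omega>] by (rule order_trans) simp
        then show ?thesis by (simp add: divide_le_eq del: of_nat_max)
      qed
      also have "1 \<le> ?b \<omega>" using True e' level_pos by (auto simp: indicator_def)
      finally show ?thesis .
    next
      case False
      obtain \<tau> where \<tau>: "\<tau> permutes UNIV" "loss n (Cpi n) \<tau> \<omega> \<le> \<alpha> * real (?k \<omega>) + ?e \<omega>"
        using loss_plugin_le[OF elim(2)] False by blast
      have "c * real n \<le> (\<Sum>i=1..n. of_bool (T (X i \<omega>) < t))"
        using False elim(2) by (simp add: undershoot_def sum_subtractf not_less mult.commute)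
      also have "\<dots> \<le> real (?k \<omega>)"
        using card_Shat_ge[OF elim(2), of n r t] False elim(2) by (simp add: overshoot_def not_less)
      finally have k: "c * real n \<le> real (?k \<omega>)" .
      have cn: "0 < c * real n" using c n by simp
      have k1: "0 < ?k \<omega>" using k cn by (cases "?k \<omega>") auto
      have "cond_risk n (Cpi n) ?w \<omega> \<le> ?w (data X n \<omega>) * loss n (Cpi n) \<tau> \<omega>"
        using elim(1) \<tau>(1) by blast
      also have "\<dots> = loss n (Cpi n) \<tau> \<omega> / real (?k \<omega>)"
        using k1 by (simp add: max_def)
      also have "\<dots> \<le> (\<alpha> * real (?k \<omega>) + ?e \<omega>) / real (?k \<omega>)"
        using \<tau>(2) by (intro divide_right_mono) auto
      also have "\<dots> = \<alpha> + ?e \<omega> / real (?k \<omega>)" using k1 by (simp add: add_divide_distrib)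
      also have "?e \<omega> / real (?k \<omega>) \<le> ?e \<omega> / (c * real n)"
        using e k cn k1 by (intro divide_left_mono) auto
      finally show ?thesis using False by (simp add: indicator_def)
    qed
  qed
  then have "FMR M Z X n (Cpi n) \<le> expectation ?b"
    unfolding FMR_eq using inte integrable_cond_risk[OF plugin_procedure w wb]
    by (intro integral_mono_AE Bochner_Integration.integrable_add) (auto intro: integrable_indicator_event)
  also have "\<dots> = \<alpha> + 1 / (c * real n) * (real n * (\<integral>x. env r x \<partial>PX)) + (prob (bad n r)
      + (prob (overshoot n r t) + prob (undershoot n c t)))"
  proof -
    have "expectation ?b = expectation (\<lambda>\<omega>. \<alpha> + 1 / (c * real n) * ?e \<omega>) + expectation (\<lambda>\<omega>. indicator (bad n r) \<omega> +
      (indicator (overshoot n r t) \<omega> + indicator (undershoot n c t) \<omega>))"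
      using inte by (intro Bochner_Integration.integral_add Bochner_Integration.integrable_add)
        (auto intro: integrable_indicator_event)
    also have "expectation (\<lambda>\<omega>. \<alpha> + 1 / (c * real n) * ?e \<omega>) = \<alpha> + 1 / (c * real n) * expectation ?e"
      using inte by (simp add: prob_space)
    also have "expectation ?e = real n * (\<integral>x. env r x \<partial>PX)" by (rule expectation_sum_X[OF env_measurable env_abs])
    finally show ?thesis
      by (simp add: integrable_indicator_event bad_measurable overshoot_measurable undershoot_measurable)
  qed
  also have "1 / (c * real n) * (real n * (\<integral>x. env r x \<partial>PX)) = (\<integral>x. env r x \<partial>PX) / c"
    using n by simp
  finally show ?thesis .
qed

section \<open>Passage to the limit\<close>

lemma limsup_FMR: "limsup (\<lambda>n. ereal (FMR M Z X n (Cpi n))) \<le> ereal \<alpha>"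
proof (rule limsup_ereal_leI)
  fix e :: real assume e: "0 < e"
  obtain t0 ts where t: "t0 < ts" "0 < Tcdf t0" "\<And>t. t0 \<le> t \<Longrightarrow> t < ts \<Longrightarrow> excess \<alpha> t < 0"
    using oracle_threshold[OF level] by metis
  \<comment> \<open>Half of the mass below \<open>t0\<close>, so that \<open>c\<close> is strictly
    below the limiting proportion and \<open>undershoot\<close> is unlikely.\<close>
  define c where "c = Tcdf t0 / 2"
  have c: "0 < c" "c < Tcdf t0" using t(2) by (auto simp: c_def)
  have "0 < min (- excess \<alpha> t0) (c * e / 2)" using t(1,3) c e by simp
  \<comment> \<open>The first bound makes the mean of the drift at \<open>t0\<close> negative, so
    that \<open>overshoot\<close> is unlikely; the second leaves less than \<open>e / 2\<close>
    after division by \<open>c\<close>.\<close>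
  then obtain r where r: "0 < r" "(\<integral>x. env r x \<partial>PX) < min (- excess \<alpha> t0) (c * e / 2)"
    using integral_env_small by blast
  have "(\<lambda>n. prob (bad n r) + (prob (overshoot n r t0) + prob (undershoot n c t0))) \<longlonglongrightarrow> 0 + (0 + 0)"
    using r c by (intro tendsto_add prob_bad prob_overshoot prob_undershoot) auto
  then have "eventually (\<lambda>n. prob (bad n r) + (prob (overshoot n r t0) + prob (undershoot n c t0)) < e / 2)
      sequentially"
    using e by (intro order_tendstoD(2)) auto
  then show "eventually (\<lambda>n. FMR M Z X n (Cpi n) \<le> \<alpha> + e) sequentially"
    using eventually_ge_at_top[of 1]
  proof eventually_elim
    case (elim n)
    have "(\<integral>x. env r x \<partial>PX) / c < e / 2" using r(2) c by (simp add: divide_less_eq mult.commute)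
    then show ?case using FMR_plugin_le[OF c(1) elim(2), of r t0] elim(1) by linarith
  qed
qed

lemma limsup_mFMR: "limsup (\<lambda>n. ereal (mFMR M Z X n (Cpi n))) \<le> ereal \<alpha>"
proof (rule limsup_ereal_leI)
  fix e :: real assume e: "0 < e"
  obtain t0 ts where t: "t0 < ts" "0 < Tcdf t0" "\<And>t. t0 \<le> t \<Longrightarrow> t < ts \<Longrightarrow> excess \<alpha> t < 0"
    using oracle_threshold[OF level] by metis
  define c where "c = Tcdf t0 / 2"
  have c: "0 < c" using t(2) by (auto simp: c_def)
  have "0 < min (- excess \<alpha> t0) (c * e / 2)" using t(1,3) c e by simp
  then obtain r where r: "0 < r" "(\<integral>x. env r x \<partial>PX) < min (- excess \<alpha> t0) (c * e / 2)"
    using integral_env_small by blast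
  have "(\<lambda>n. prob (bad n r) + prob (overshoot n r t0)) \<longlonglongrightarrow> 0 + 0"
    using r by (intro tendsto_add prob_bad prob_overshoot) auto
  \<comment> \<open>The bound \<open>c\<close> leaves half of \<open>Tcdf t0\<close> for the
    expected selected proportion; the bound \<open>c * e / 2\<close> and the mean envelope together
    contribute at most \<open>c * e\<close>, which the proportion \<open>c\<close> turns into
    \<open>e\<close>.\<close>
  then have "eventually (\<lambda>n. prob (bad n r) + prob (overshoot n r t0) < min c (c * e / 2)) sequentially"
    using c e by (intro order_tendstoD(2)) auto
  then show "eventually (\<lambda>n. mFMR M Z X n (Cpi n) \<le> \<alpha> + e) sequentially"
    using eventually_ge_at_top[of 1]
  proof eventually_elim
    case (elim n)
    let ?N = "exp_selected M X n (Cpi n)"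
    have p: "prob (bad n r) + prob (overshoot n r t0) < c" "prob (bad n r) + prob (overshoot n r t0) < c * e / 2"
      using elim(1) by auto
    have "real n * c \<le> real n * (Tcdf t0 - prob (bad n r) - prob (overshoot n r t0))"
      using p(1) by (intro mult_left_mono) (auto simp: c_def)
    also have "\<dots> \<le> ?N" by (rule exp_selected_plugin_ge)
    finally have N: "real n * c \<le> ?N" .
    then have N0: "0 < ?N" using elim(2) c by (meson less_le_trans mult_pos_pos of_nat_0_less_iff zero_less_one)
    have "(\<integral>x. env r x \<partial>PX) + prob (bad n r) \<le> c * e"
      using r(2) p(2) measure_nonneg[of M "overshoot n r t0"] by linarith
    then have "real n * ((\<integral>x. env r x \<partial>PX) + prob (bad n r)) \<le> real n * (c * e)"
      by (intro mult_left_mono) auto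
    also have "\<dots> \<le> ?N * e" using N e by (simp add: mult.assoc[symmetric] mult_right_mono)
    finally have "expectation (cond_risk n (Cpi n) (\<lambda>_. 1)) \<le> (\<alpha> + e) * ?N"
      using cond_risk_plugin_le[of n r] by (simp add: algebra_simps)
    then show ?case using N0 by (simp add: mFMR_eq divide_le_eq)
  qed
qed

lemma liminf_selected:
  assumes C: "\<And>n. procedure n (C n)" and risk: "\<And>n. mFMR M Z X n (C n) \<le> \<alpha>"
  shows "0 \<le> liminf (\<lambda>n. ereal (exp_selected M X n (Cpi n) / real n - exp_selected M X n (C n) / real n))"
  unfolding zero_ereal_def
proof (rule liminf_ereal_geI)
  fix e :: real assume e: "0 < e"
  obtain t0 ts where t: "t0 < ts" "\<alpha> < ts" "0 \<le> excess \<alpha> ts" "\<And>t. t0 \<le> t \<Longrightarrow> t < ts \<Longrightarrow> excess \<alpha> t < 0"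
    using oracle_threshold[OF level] by metis
  have "isCont Tcdf ts" using continuous_Tcdf by (simp add: continuous_on_eq_continuous_at)
  then obtain d where d: "0 < d" "\<And>t. dist t ts < d \<Longrightarrow> dist (Tcdf t) (Tcdf ts) < e / 2"
    unfolding continuous_at_eps_delta using e half_gt_zero by blast
  \<comment> \<open>Within \<open>d\<close> of \<open>ts\<close> for the continuity of
    \<open>Tcdf\<close>, and in the range from \<open>t0\<close> to below \<open>ts\<close> where
    the excess is negative.\<close>
  define t where "t = max t0 (ts - d / 2)"
  have ex: "excess \<alpha> t < 0" using t(1,4) d(1) by (auto simp: t_def)
  have "dist t ts < d" using t(1) d(1) by (auto simp: t_def dist_real_def)
  then have cdf: "Tcdf ts - e / 2 < Tcdf t" using d(2)[of t] unfolding dist_real_def by linarith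
  obtain r where r: "0 < r" "(\<integral>x. env r x \<partial>PX) < - excess \<alpha> t"
    using integral_env_small[of "- excess \<alpha> t"] ex by auto
  have "(\<lambda>n. prob (bad n r) + prob (overshoot n r t)) \<longlonglongrightarrow> 0 + 0"
    using r by (intro tendsto_add prob_bad prob_overshoot) auto
  then have "eventually (\<lambda>n. prob (bad n r) + prob (overshoot n r t) < e / 2) sequentially"
    using e by (intro order_tendstoD(2)) auto
  then show "eventually (\<lambda>n. 0 - e \<le> exp_selected M X n (Cpi n) / real n - exp_selected M X n (C n) / real n)
      sequentially"
    using eventually_ge_at_top[of 1]
  proof eventually_elim
    case (elim n)
    have n: "0 < real n" using elim(2) by simp
    \<comment> \<open>The Lagrangian bound is applied at \<open>ts\<close> itself, which exceeds
      \<alpha> and has nonnegative excess.\<close>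
    have "exp_selected M X n (C n) \<le> real n * Tcdf ts"
      using exp_selected_le[OF C risk t(2)] t(3) by (simp add: excess_def Tcdf_def)
    then have "exp_selected M X n (C n) / real n \<le> Tcdf ts" using n by (simp add: divide_le_eq mult.commute)
    moreover have "Tcdf t - prob (bad n r) - prob (overshoot n r t) \<le> exp_selected M X n (Cpi n) / real n"
      using exp_selected_plugin_ge[of n t r] n by (simp add: le_divide_eq mult.commute)
    ultimately show ?case using elim(1) cdf by linarith
  qed
qed

end

theorem theorem1:
  fixes U :: "'u::euclidean_space set"
    and F :: "'u \<Rightarrow> (real ^ 'd) measure"
    and f :: "'u \<Rightarrow> real ^ 'd \<Rightarrow> real"
    and \<Theta> :: "('q::finite, 'u) param set"
    and V :: "(real ^ 'k) set"
    and \<theta>s :: "('q, 'u) param"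
    and M :: "'w measure"
    and Z :: "nat \<Rightarrow> 'w \<Rightarrow> 'q"
    and X :: "nat \<Rightarrow> 'w \<Rightarrow> real ^ 'd"
    and D :: "('q, 'u) param set"
    and \<theta>hat :: "nat \<Rightarrow> (nat \<Rightarrow> real ^ 'd) \<Rightarrow> ('q, 'u) param"
    and \<alpha> :: real
    and Cpi :: "nat \<Rightarrow> ('q, 'd) proc"
  assumes family: "density_family U F f"
    and params: "\<Theta> \<subseteq> valid_params U"
    and open_params: "open V" "\<Theta> homeomorphic V"
    and true_param: "\<theta>s \<in> \<Theta>"
    and space: "prob_space M"
    and indep: "prob_space.indep_vars M (\<lambda>_. count_space UNIV \<Otimes>\<^sub>M borel)
                  (\<lambda>i \<omega>. (Z i \<omega>, X i \<omega>)) {1..}"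
    and law: "\<forall>i\<ge>1. distr M (count_space UNIV \<Otimes>\<^sub>M borel) (\<lambda>\<omega>. (Z i \<omega>, X i \<omega>)) = mix_law F \<theta>s"
    and A1_continuous: "\<forall>\<theta>\<in>\<Theta>. \<forall>q. \<forall>c. measure (obs_law F \<theta>s) {x. post f q x \<theta> = c} = 0"
    and A1_increasing: "strict_mono_on {alpha_crit F f \<theta>s<..<alpha_bar F f \<theta>s}
                          (\<lambda>t. measure (obs_law F \<theta>s) {x. Tstat f x \<theta>s < t})"
    and A2: "AE x in obs_law F \<theta>s. continuous_on U (\<lambda>u. f u x)"
    and A3: "vc_dim {(\<lambda>x. post f q x \<theta>) |q \<theta>. \<theta> \<in> \<Theta>} < \<infinity>"
            "vc_dim {(\<lambda>x. of_bool (post f q x \<theta> - post f q' x \<theta> \<ge> 0)) |q q' \<theta>. \<theta> \<in> \<Theta>} < \<infinity>"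
    and countable: "countable D" "D \<subseteq> \<Theta>"
    and estimator: "\<forall>n. \<theta>hat n \<in> data_space n \<rightarrow>\<^sub>M borel"
                   "\<forall>n. \<forall>x\<in>space (data_space n). \<theta>hat n x \<in> D"
    and consistent: "\<forall>\<epsilon>>0. (\<lambda>n. measure M {\<omega> \<in> space M.
          (MIN \<sigma>\<in>{\<sigma>. \<sigma> permutes UNIV}. norm (permuted \<sigma> (\<theta>hat n (data X n \<omega>)) - \<theta>s)) \<ge> \<epsilon>})
          \<longlonglongrightarrow> 0"
    and level: "alpha_crit F f \<theta>s < \<alpha>" "\<alpha> < alpha_bar F f \<theta>s"
    and plugin: "\<forall>n. procedure n (Cpi n)" "\<forall>n. is_plugin f \<alpha> n (\<theta>hat n) (Cpi n)"
  shows "limsup (\<lambda>n. ereal (FMR M Z X n (Cpi n))) \<le> ereal \<alpha>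
    \<and> limsup (\<lambda>n. ereal (mFMR M Z X n (Cpi n))) \<le> ereal \<alpha>
    \<and> (\<forall>C :: nat \<Rightarrow> ('q, 'd) proc.
         (\<forall>n. procedure n (C n)) \<and> (\<forall>n. mFMR M Z X n (C n) \<le> \<alpha>) \<longrightarrow>
         0 \<le> liminf (\<lambda>n. ereal (exp_selected M X n (Cpi n) / real n
                                - exp_selected M X n (C n) / real n)))"
proof -
  interpret prob_space M by (rule space)
  interpret plugin_estimator M U F f \<theta>s Z X D \<theta>hat \<alpha> Cpi
  proof
    show "\<theta>s \<in> valid_params U" using params true_param by blast
    show "D \<subseteq> valid_params U" using params countable(2) by blast
    show "\<theta>hat n x \<in> D" if "x \<in> space (data_space n)" for n x using estimator(2) that by blast
    show "(\<lambda>n. prob {\<omega> \<in> space M. \<epsilon> \<le>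
        (MIN \<sigma>\<in>{\<sigma>. \<sigma> permutes UNIV}. norm (permuted \<sigma> (\<theta>hat n (data X n \<omega>)) - \<theta>s))}) \<longlonglongrightarrow> 0"
      if "0 < \<epsilon>" for \<epsilon> using consistent that by blast
  qed (use family indep law A1_continuous true_param A2 countable(1) estimator(1) level plugin in auto)
  show ?thesis using limsup_FMR limsup_mFMR liminf_selected by blast
qed

end
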